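(* (Perrin's formula.) For every $a\in A$ the following properties are equivalent: (i) $a\in\mathfrak{A}$. (ii) There exists a polynomial $Q\in A[T_1,\dots,T_r]$ without constant term such that $a=Q(\widetilde{f}_1,\dots,\widetilde{f}_r)$.
   Context: Let $K$ be a commutative integral domain, $s\ge 1$, and $n_s\ge\dots\ge n_1\ge 1$ integers. For $1\le j\le s$ let $\underline{X}_j=(X_{j,1},\dots,X_{j,n_j+1})$ be a packet of indeterminates; for $\underline{\alpha}_j\in\mathbb{N}^{n_j+1}$ let $|\underline{\alpha}_j|$ be the sum of its entries and $\underline{X}_j^{\underline{\alpha}_j}$ the corresponding monomial. Let $r\in\mathbb{N}$ and $d_{i,j}\ge 1$ ($1\le i\le r$, $1\le j\le s$) be integers. Let $A=K[U_{i,\underline{\alpha}_1,\dots,\underline{\alpha}_s}]$ be the polynomial ring in indeterminates indexed by $1\le i\le r$ and $\underline{\alpha}_j\in\mathbb{N}^{n_j+1}$ with $|\underline{\alpha}_j|=d_{i,j}$ for all $j$. Let $C=A[\underline{X}_1,\dots,\underline{X}_s]$, $f_i=\sum U_{i,\underline{\alpha}_1,\dots,\underline{\alpha}_s}\underline{X}_1^{\underline{\alpha}_1}\cdots\underline{X}_s^{\underline{\alpha}_s}\in C$ (sum over all $(\underline{\alpha}_j)_j$ with $|\underline{\alpha}_j|=d_{i,j}$), and $B=C/(f_1,\dots,f_r)$. For $1\le i_j\le n_j+1$ put $\sigma_{i_1\dots i_s}=X_{1,i_1}\cdots X_{s,i_s}$. Let $p:C\to B$ be the canonical surjection and $\pi:B\to\prod_{i_1,\dots,i_s}B_{\sigma_{i_1\dots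 i_s}}$, $b\mapsto(b/1,\dots,b/1)$. The ideal of forms of inertia is $\mathcal{T}=p^{-1}(\ker\pi)\subset C$, and the resultant ideal is $\mathfrak{A}=\mathcal{T}\cap A$. $T_1,\dots,T_r$ are new indeterminates. $\widetilde{f}_i$ is the polynomial obtained from $f_i$ by substituting $1$ for each of the variables $X_{1,n_1+1},\dots,X_{s,n_s+1}$. The equality in (ii) is in the polynomial ring over $A$ in the remaining variables $X_{j,l}$, $1\le l\le n_j$. *)

theory Defs
  imports "HOL-Library.Poly_Mapping" "HOL-Algebra.QuotRing"
begin

text \<open>
  Monomials with variables in \<open>'v\<close> are finitely supported exponent functions
  \<open>'v \<Rightarrow>\<^sub>0 nat\<close>; polynomials are finitely supported functions from monomials to
  coefficients, with the convolution product of \<open>HOL-Library.Poly_Mapping\<close>.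
\<close>

type_synonym ('v, 'a) mpoly = "('v \<Rightarrow>\<^sub>0 nat) \<Rightarrow>\<^sub>0 'a"

definition mconst :: "'a::comm_ring_1 \<Rightarrow> ('v, 'a) mpoly"
  where "mconst c = Poly_Mapping.single 0 c"

definition mmonom :: "('v \<Rightarrow>\<^sub>0 nat) \<Rightarrow> ('v, 'a::comm_ring_1) mpoly"
  where "mmonom m = Poly_Mapping.single m 1"

definition mvar :: "'v \<Rightarrow> ('v, 'a::comm_ring_1) mpoly"
  where "mvar v = mmonom (Poly_Mapping.single v 1)"

text \<open>
  \<open>mpoly_ring R V\<close> is the ring \<open>R[V]\<close>, where \<open>R\<close> is (the carrier of) a subring of the
  ambient coefficient type and \<open>V\<close> is the set of indeterminates.
\<close>

definition mpoly_ring :: "'a::comm_ring_1 set \<Rightarrow> 'v set \<Rightarrow> ('v, 'a) mpoly ring"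
  where "mpoly_ring R V =
    \<lparr>carrier = {q. \<forall>m \<in> Poly_Mapping.keys q.
                     Poly_Mapping.lookup q m \<in> R \<and> Poly_Mapping.keys m \<subseteq> V},
     monoid.mult = (*), one = 1, ring.zero = 0, add = (+)\<rparr>"

definition mpoly_eval ::
  "('a::comm_ring_1 \<Rightarrow> 'b::comm_ring_1) \<Rightarrow> ('v \<Rightarrow> 'b) \<Rightarrow> ('v, 'a) mpoly \<Rightarrow> 'b"
  where "mpoly_eval h g q =
    (\<Sum>m \<in> Poly_Mapping.keys q. h (Poly_Mapping.lookup q m) *
       (\<Prod>v \<in> Poly_Mapping.keys m. g v ^ Poly_Mapping.lookup m v))"

text \<open>The localization of a commutative ring \<open>R\<close> at a multiplicative set \<open>S\<close>; \<open>loc_frac R S a s\<close> is the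
  fraction \<open>a/s\<close>. The factor \<open>u\<close> is needed because \<open>S\<close> may contain zero divisors.\<close>

definition loc_rel ::
  "('a, 'm) ring_scheme \<Rightarrow> 'a set \<Rightarrow> (('a \<times> 'a) \<times> ('a \<times> 'a)) set"
  where "loc_rel R S =
    {((a, s), (b, t)) | a s b t. a \<in> carrier R \<and> s \<in> S \<and> b \<in> carrier R \<and> t \<in> S \<and>
       (\<exists>u \<in> S. u \<otimes>\<^bsub>R\<^esub> (a \<otimes>\<^bsub>R\<^esub> t) = u \<otimes>\<^bsub>R\<^esub> (b \<otimes>\<^bsub>R\<^esub> s))}"

definition loc_frac :: "('a, 'm) ring_scheme \<Rightarrow> 'a set \<Rightarrow> 'a \<Rightarrow> 'a \<Rightarrow> ('a \<times> 'a) set"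
  where "loc_frac R S a s = loc_rel R S `` {(a, s)}"

definition localization :: "('a, 'm) ring_scheme \<Rightarrow> 'a set \<Rightarrow> ('a \<times> 'a) set ring"
  where "localization R S =
    \<lparr>carrier = (carrier R \<times> S) // loc_rel R S,
     monoid.mult = (\<lambda>x y. \<Union>(a, s) \<in> x. \<Union>(b, t) \<in> y. loc_frac R S (a \<otimes>\<^bsub>R\<^esub> b) (s \<otimes>\<^bsub>R\<^esub> t)),
     one = loc_frac R S \<one>\<^bsub>R\<^esub> \<one>\<^bsub>R\<^esub>,
     ring.zero = loc_frac R S \<zero>\<^bsub>R\<^esub> \<one>\<^bsub>R\<^esub>,
     add = (\<lambda>x y. \<Union>(a, s) \<in> x. \<Union>(b, t) \<in> y.
              loc_frac R S ((a \<otimes>\<^bsub>R\<^esub> t) \<oplus>\<^bsub>R\<^esub> (b \<otimes>\<^bsub>R\<^esub> s)) (s \<otimes>\<^bsub>R\<^esub> t))\<rparr>"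

definition powers :: "('a, 'm) ring_scheme \<Rightarrow> 'a \<Rightarrow> 'a set"
  where "powers R x = {x [^]\<^bsub>R\<^esub> k | k::nat. True}"

definition product_ring :: "'i set \<Rightarrow> ('i \<Rightarrow> ('a, 'm) ring_scheme) \<Rightarrow> ('i \<Rightarrow> 'a) ring"
  where "product_ring I R =
    \<lparr>carrier = (\<Pi>\<^sub>E i\<in>I. carrier (R i)),
     monoid.mult = (\<lambda>x y. \<lambda>i\<in>I. x i \<otimes>\<^bsub>R i\<^esub> y i),
     one = (\<lambda>i\<in>I. \<one>\<^bsub>R i\<^esub>),
     ring.zero = (\<lambda>i\<in>I. \<zero>\<^bsub>R i\<^esub>),
     add = (\<lambda>x y. \<lambda>i\<in>I. x i \<oplus>\<^bsub>R i\<^esub> y i)\<rparr>"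

text \<open>
  Throughout, \<open>s\<close> is the number of packets, packet \<open>j \<in> {1..s}\<close> has the \<open>n j + 1\<close>
  indeterminates \<open>X\<^bsub>j,l\<^esub>\<close>, \<open>r\<close> is the number of polynomials, and \<open>d i j\<close> is the degree of the
  \<open>i\<close>-th polynomial in packet \<open>j\<close>. The indeterminate \<open>X\<^bsub>j,l\<^esub>\<close> is represented by \<open>(j, l)\<close>. A tuple of
  exponent vectors, one for each packet, is the same thing as a monomial in all the
  \<open>X\<^bsub>j,l\<^esub>\<close>, and the coefficient indeterminates are accordingly indexed by pairs
  \<open>(i, m)\<close> with \<open>m\<close> such a monomial.
\<close>

type_synonym xmonom = "nat \<times> nat \<Rightarrow>\<^sub>0 nat"
type_synonym 'k apoly = "(nat \<times> xmonom, 'k) mpoly"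
type_synonym 'k cpoly = "(nat \<times> nat, 'k apoly) mpoly"

definition X_vars :: "nat \<Rightarrow> (nat \<Rightarrow> nat) \<Rightarrow> (nat \<times> nat) set"
  where "X_vars s n = (SIGMA j:{1..s}. {1..n j + 1})"

definition multi_exps :: "nat \<Rightarrow> (nat \<Rightarrow> nat) \<Rightarrow> (nat \<Rightarrow> nat) \<Rightarrow> xmonom set"
  where "multi_exps s n e =
    {m. Poly_Mapping.keys m \<subseteq> X_vars s n \<and>
        (\<forall>j \<in> {1..s}. (\<Sum>l = 1..n j + 1. Poly_Mapping.lookup m (j, l)) = e j)}"

lemma finite_multi_exps: "finite (multi_exps s n e)"
proof -
  let ?B = "Max (e ` {1..s})"
  let ?F = "{f. \<forall>x. (x \<in> X_vars s n \<longrightarrow> f x \<in> {..?B}) \<and> (x \<notin> X_vars s n \<longrightarrow> f x = (0::nat))}"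
  have fX: "finite (X_vars s n)" by (simp add: X_vars_def)
  have fin: "finite ?F" by (rule finite_set_of_finite_funs) (use fX in auto)
  have "Poly_Mapping.lookup ` multi_exps s n e \<subseteq> ?F"
  proof clarify
    fix m :: xmonom and j l
    assume m: "m \<in> multi_exps s n e"
    show "((j, l) \<in> X_vars s n \<longrightarrow> Poly_Mapping.lookup m (j, l) \<in> {..?B}) \<and>
          ((j, l) \<notin> X_vars s n \<longrightarrow> Poly_Mapping.lookup m (j, l) = 0)"
    proof (intro conjI impI)
      assume jl: "(j, l) \<in> X_vars s n"
      then have j: "j \<in> {1..s}" and l: "l \<in> {1..n j + 1}" by (auto simp: X_vars_def)
      have "Poly_Mapping.lookup m (j, l) \<le> (\<Sum>l = 1..n j + 1. Poly_Mapping.lookup m (j, l))"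
        using member_le_sum[of l "{1..n j + 1}" "\<lambda>l. Poly_Mapping.lookup m (j, l)"] l by auto
      also have "\<dots> = e j" using m j by (simp add: multi_exps_def)
      also have "\<dots> \<le> ?B" using j by (intro Max_ge) auto
      finally show "Poly_Mapping.lookup m (j, l) \<in> {..?B}" by simp
    next
      assume "(j, l) \<notin> X_vars s n"
      then have "(j, l) \<notin> Poly_Mapping.keys m" using m by (auto simp: multi_exps_def)
      then show "Poly_Mapping.lookup m (j, l) = 0" by (simp add: in_keys_iff)
    qed
  qed
  then have "finite (Poly_Mapping.lookup ` multi_exps s n e)" using fin finite_subset by blast
  then show ?thesis
    by (rule finite_imageD) (simp add: inj_on_def poly_mapping_eqI)
qed

definition U_vars ::
  "nat \<Rightarrow> (nat \<Rightarrow> nat) \<Rightarrow> nat \<Rightarrow> (nat \<Rightarrow> nat \<Rightarrow> nat) \<Rightarrow> (nat \<times> xmonom) set"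
  where "U_vars s n r d = (SIGMA i:{1..r}. multi_exps s n (d i))"

definition ring_A ::
  "nat \<Rightarrow> (nat \<Rightarrow> nat) \<Rightarrow> nat \<Rightarrow> (nat \<Rightarrow> nat \<Rightarrow> nat) \<Rightarrow> 'k::comm_ring_1 apoly ring"
  where "ring_A s n r d = mpoly_ring UNIV (U_vars s n r d)"

definition ring_C ::
  "nat \<Rightarrow> (nat \<Rightarrow> nat) \<Rightarrow> nat \<Rightarrow> (nat \<Rightarrow> nat \<Rightarrow> nat) \<Rightarrow> 'k::comm_ring_1 cpoly ring"
  where "ring_C s n r d = mpoly_ring (carrier (ring_A s n r d)) (X_vars s n)"

definition gen_poly ::
  "nat \<Rightarrow> (nat \<Rightarrow> nat) \<Rightarrow> (nat \<Rightarrow> nat \<Rightarrow> nat) \<Rightarrow> nat \<Rightarrow> 'k::comm_ring_1 cpoly"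
  where "gen_poly s n d i =
    (\<Sum>m \<in> multi_exps s n (d i). mconst (mvar (i, m)) * mmonom m)"

definition gen_ideal ::
  "nat \<Rightarrow> (nat \<Rightarrow> nat) \<Rightarrow> nat \<Rightarrow> (nat \<Rightarrow> nat \<Rightarrow> nat) \<Rightarrow> 'k::comm_ring_1 cpoly set"
  where "gen_ideal s n r d = Idl\<^bsub>ring_C s n r d\<^esub> (gen_poly s n d ` {1..r})"

definition ring_B ::
  "nat \<Rightarrow> (nat \<Rightarrow> nat) \<Rightarrow> nat \<Rightarrow> (nat \<Rightarrow> nat \<Rightarrow> nat) \<Rightarrow> 'k::comm_ring_1 cpoly set ring"
  where "ring_B s n r d = ring_C s n r d Quot gen_ideal s n r d"

definition proj_B ::
  "nat \<Rightarrow> (nat \<Rightarrow> nat) \<Rightarrow> nat \<Rightarrow> (nat \<Rightarrow> nat \<Rightarrow> nat) \<Rightarrow>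
   'k::comm_ring_1 cpoly \<Rightarrow> 'k cpoly set"
  where "proj_B s n r d c = gen_ideal s n r d +>\<^bsub>ring_C s n r d\<^esub> c"

definition sigma_index :: "nat \<Rightarrow> (nat \<Rightarrow> nat) \<Rightarrow> (nat \<Rightarrow> nat) set"
  where "sigma_index s n = (\<Pi>\<^sub>E j\<in>{1..s}. {1..n j + 1})"

definition sigma :: "nat \<Rightarrow> (nat \<Rightarrow> nat) \<Rightarrow> 'k::comm_ring_1 cpoly"
  where "sigma s \<iota> = (\<Prod>j = 1..s. mvar (j, \<iota> j))"

definition sigma_powers ::
  "nat \<Rightarrow> (nat \<Rightarrow> nat) \<Rightarrow> nat \<Rightarrow> (nat \<Rightarrow> nat \<Rightarrow> nat) \<Rightarrow> (nat \<Rightarrow> nat) \<Rightarrow>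
   'k::comm_ring_1 cpoly set set"
  where "sigma_powers s n r d \<iota> = powers (ring_B s n r d) (proj_B s n r d (sigma s \<iota>))"

definition B_sigma ::
  "nat \<Rightarrow> (nat \<Rightarrow> nat) \<Rightarrow> nat \<Rightarrow> (nat \<Rightarrow> nat \<Rightarrow> nat) \<Rightarrow> (nat \<Rightarrow> nat) \<Rightarrow>
   ('k::comm_ring_1 cpoly set \<times> 'k cpoly set) set ring"
  where "B_sigma s n r d \<iota> = localization (ring_B s n r d) (sigma_powers s n r d \<iota>)"

definition loc_map ::
  "nat \<Rightarrow> (nat \<Rightarrow> nat) \<Rightarrow> nat \<Rightarrow> (nat \<Rightarrow> nat \<Rightarrow> nat) \<Rightarrow>
   'k::comm_ring_1 cpoly set \<Rightarrow> (nat \<Rightarrow> nat) \<Rightarrow> ('k cpoly set \<times> 'k cpoly set) set"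
  where "loc_map s n r d b =
    (\<lambda>\<iota>\<in>sigma_index s n.
       loc_frac (ring_B s n r d) (sigma_powers s n r d \<iota>) b \<one>\<^bsub>ring_B s n r d\<^esub>)"

definition inertia_forms ::
  "nat \<Rightarrow> (nat \<Rightarrow> nat) \<Rightarrow> nat \<Rightarrow> (nat \<Rightarrow> nat \<Rightarrow> nat) \<Rightarrow> 'k::comm_ring_1 cpoly set"
  where "inertia_forms s n r d =
    {c \<in> carrier (ring_C s n r d).
       proj_B s n r d c \<in>
         a_kernel (ring_B s n r d) (product_ring (sigma_index s n) (B_sigma s n r d))
           (loc_map s n r d)}"

definition resultant_ideal ::
  "nat \<Rightarrow> (nat \<Rightarrow> nat) \<Rightarrow> nat \<Rightarrow> (nat \<Rightarrow> nat \<Rightarrow> nat) \<Rightarrow> 'k::comm_ring_1 apoly set"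
  where "resultant_ideal s n r d =
    {a \<in> carrier (ring_A s n r d). mconst a \<in> inertia_forms s n r d}"

definition dehom_poly ::
  "nat \<Rightarrow> (nat \<Rightarrow> nat) \<Rightarrow> (nat \<Rightarrow> nat \<Rightarrow> nat) \<Rightarrow> nat \<Rightarrow> 'k::comm_ring_1 cpoly"
  where "dehom_poly s n d i =
    mpoly_eval mconst (\<lambda>(j, l). if l = n j + 1 then 1 else mvar (j, l)) (gen_poly s n d i)"

end

theory Submission
  imports Defs
begin

text \<open>
  Choose one variable \<open>X\<^bsub>j,\<iota> j\<^esub>\<close> in each packet, and call the coefficient of \<open>f\<^sub>i\<close> at the product of the
  \<open>X\<^bsub>j,\<iota> j\<^esub>\<close> to the powers \<open>d i j\<close> its pivot coefficient \<open>\<epsilon>\<^sub>i\<close>. Setting the chosen variables to \<open>1\<close>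
  turns \<open>f\<^sub>i\<close> into \<open>F\<^sub>i = \<epsilon>\<^sub>i + h\<^sub>i\<close>, where no pivot coefficient occurs in \<open>h\<^sub>i\<close>; so on this chart (where the
  chosen variables are invertible) the
  equations \<open>f\<^sub>i = 0\<close> can be solved for the \<open>\<epsilon>\<^sub>i\<close>. The solution is the homomorphism \<open>\<psi>\<close> from \<open>A\<close> to
  the polynomial ring over \<open>A\<close> that replaces \<open>\<epsilon>\<^sub>i\<close> by \<open>\<epsilon>\<^sub>i - F\<^sub>i = - h\<^sub>i\<close>
  (\<open>elim_coeff\<close> below). The theorem holds because both properties of \<open>a\<close> say that \<open>\<psi> a = 0\<close>.

  For the resultant ideal, membership means that for every choice of \<open>\<iota>\<close> some power of \<open>\<sigma>\<^sub>\<iota>\<close>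
  multiplies \<open>a\<close> into the ideal of the \<open>f\<^sub>i\<close> (lemma \<open>inertia_forms_iff\<close>). The extension of \<open>\<psi>\<close> to
  \<open>C\<close> that sets the chosen variables to \<open>1\<close> kills that ideal and maps the other \<open>\<sigma>\<close>'s to monomials.
  Monomials are not zero divisors, so a relation for one choice of \<open>\<iota>\<close> forces \<open>\<psi> a = 0\<close> for all choices
  (\<open>elim_coeff_eq_zero_if\<close>). Conversely, \<open>\<psi> a\<close> is the dehomogenization of a
  multihomogeneous polynomial congruent to \<open>\<sigma>\<^sub>\<iota>\<close>-power times \<open>a\<close> (\<open>multihomogeneous_lift\<close>), and a
  multihomogeneous polynomial is determined by its dehomogenization; thus \<open>\<psi> a = 0\<close> gives back a
  relation for that choice (\<open>elim_coeff_eq_zero_imp\<close>).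

  For Perrin's formula, take the last variable of each packet. If \<open>\<psi> a = 0\<close>, then
  \<open>Q = a - a(\<epsilon>\<^sub>i - T\<^sub>i)\<close> has no constant term and takes the value \<open>a - \<psi> a = a\<close> at the \<open>F\<^sub>i\<close>. In the
  other direction, the extension of \<open>\<psi>\<close> kills every \<open>F\<^sub>i\<close>, hence also \<open>a = Q(F\<^sub>1, \<dots>, F\<^sub>r)\<close>
  whenever \<open>Q\<close> has no constant term.
\<close>

section \<open>Evaluation homomorphisms of polynomial rings\<close>

text \<open>
  All rings of the statement are subrings of polynomial types that are commutative rings as types.
  The homomorphisms that are needed are defined on the whole types, so no carriers enter here.
\<close>

locale unital_hom =
  fixes h :: "'a::comm_ring_1 \<Rightarrow> 'b::comm_ring_1"
  assumes one [simp]: "h 1 = 1"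
    and add: "h (x + y) = h x + h y"
    and mult: "h (x * y) = h x * h y"
begin

lemma zero [simp]: "h 0 = 0"
  using add[of 0 0] by simp

lemma diff: "h (x - y) = h x - h y"
  using add[of "x - y" y] by (simp add: algebra_simps)

lemma hom_sum: "h (sum f S) = (\<Sum>x\<in>S. h (f x))"
  by (induction S rule: infinite_finite_induct) (auto simp: add)

lemma hom_prod: "h (prod f S) = (\<Prod>x\<in>S. h (f x))"
  by (induction S rule: infinite_finite_induct) (auto simp: mult)

lemma power: "h (x ^ k) = h x ^ k"
  by (induction k) (auto simp: mult)

end

lemma unital_hom_compose: "unital_hom h \<Longrightarrow> unital_hom h' \<Longrightarrow> unital_hom (\<lambda>x. h (h' x))"
  by (simp add: unital_hom_def)

lemma unital_hom_id: "unital_hom (\<lambda>x. x)"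
  by (simp add: unital_hom_def)

lemma mconst_hom: "unital_hom (mconst :: 'a::comm_ring_1 \<Rightarrow> ('v, 'a) mpoly)"
  by (simp add: unital_hom_def mconst_def single_add mult_single)

lemma mmonom_add: "mmonom (m + m') = mmonom m * mmonom m'"
  by (simp add: mmonom_def mult_single)

lemma mmonom_0: "mmonom 0 = 1"
  by (simp add: mmonom_def)

lemma mmonom_sum: "mmonom (sum f S) = (\<Prod>v\<in>S. mmonom (f v))"
  by (induction S rule: infinite_finite_induct) (auto simp: mmonom_0 mmonom_add)

lemma mvar_power: "mvar v ^ k = mmonom (Poly_Mapping.single v k)"
  by (induction k) (simp_all add: mmonom_0 mvar_def mmonom_add[symmetric] single_add[symmetric])

lemma mconst_mult_mmonom: "mconst c * mmonom m = Poly_Mapping.single m c"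
  by (simp add: mconst_def mmonom_def mult_single)

definition monom_eval :: "('v \<Rightarrow> 'b::comm_ring_1) \<Rightarrow> ('v \<Rightarrow>\<^sub>0 nat) \<Rightarrow> 'b"
  where "monom_eval g m = (\<Prod>v \<in> Poly_Mapping.keys m. g v ^ Poly_Mapping.lookup m v)"

lemma monom_eval_superset:
  assumes "finite S" "Poly_Mapping.keys m \<subseteq> S"
  shows "monom_eval g m = (\<Prod>v \<in> S. g v ^ Poly_Mapping.lookup m v)"
  unfolding monom_eval_def
  by (rule prod.mono_neutral_left) (use assms in \<open>auto simp: in_keys_iff\<close>)

lemma monom_eval_add: "monom_eval g (m + m') = monom_eval g m * monom_eval g m'"
proof -
  let ?S = "Poly_Mapping.keys m \<union> Poly_Mapping.keys m'"
  have "Poly_Mapping.keys (m + m') \<subseteq> ?S" by (rule Poly_Mapping.keys_add)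
  then show ?thesis
    by (simp add: monom_eval_superset[of ?S] lookup_add power_add prod.distrib)
qed

lemma monom_eval_0 [simp]: "monom_eval g 0 = 1"
  by (simp add: monom_eval_def)

lemma monom_eval_single [simp]: "monom_eval g (Poly_Mapping.single v k) = g v ^ k"
  by (simp add: monom_eval_def)

lemma sum_singles: "(\<Sum>x\<in>Poly_Mapping.keys f. Poly_Mapping.single x (Poly_Mapping.lookup f x)) = f"
  by (rule poly_mapping_eqI) (simp add: lookup_sum lookup_single when_def in_keys_iff)

lemma monom_eval_mvar: "monom_eval (mvar :: 'v \<Rightarrow> ('v, 'a::comm_ring_1) mpoly) m = mmonom m"
proof -
  have "monom_eval (mvar :: 'v \<Rightarrow> ('v, 'a) mpoly) m =
      mmonom (\<Sum>v\<in>Poly_Mapping.keys m. Poly_Mapping.single v (Poly_Mapping.lookup m v))"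
    by (simp add: monom_eval_def mvar_power mmonom_sum)
  then show ?thesis by (simp only: sum_singles)
qed

lemma mpoly_eval_superset:
  assumes "unital_hom h" "finite S" "Poly_Mapping.keys q \<subseteq> S"
  shows "mpoly_eval h g q = (\<Sum>m \<in> S. h (Poly_Mapping.lookup q m) * monom_eval g m)"
  unfolding mpoly_eval_def monom_eval_def
  by (rule sum.mono_neutral_left)
    (use assms unital_hom.zero[OF assms(1)] in \<open>auto simp: in_keys_iff\<close>)

lemma mpoly_eval_single:
  assumes "unital_hom h"
  shows "mpoly_eval h g (Poly_Mapping.single m c) = h c * monom_eval g m"
  using mpoly_eval_superset[OF assms, of "{m}" "Poly_Mapping.single m c" g] by simp

lemma mpoly_eval_add:
  assumes "unital_hom h"
  shows "mpoly_eval h g (p + q) = mpoly_eval h g p + mpoly_eval h g q"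
proof -
  let ?S = "Poly_Mapping.keys p \<union> Poly_Mapping.keys q"
  have "Poly_Mapping.keys (p + q) \<subseteq> ?S" by (rule Poly_Mapping.keys_add)
  then show ?thesis
    by (simp add: mpoly_eval_superset[OF assms, of ?S] lookup_add unital_hom.add[OF assms]
        distrib_right sum.distrib)
qed

lemma mpoly_eval_sum:
  assumes "unital_hom h"
  shows "mpoly_eval h g (sum f S) = (\<Sum>x\<in>S. mpoly_eval h g (f x))"
  by (induction S rule: infinite_finite_induct)
    (auto simp: mpoly_eval_add[OF assms] mpoly_eval_def[of _ _ 0])

text \<open>
  The universal property of the polynomial ring: \<open>h\<close> acts on the coefficients and \<open>g\<close> prescribes the
  images of the indeterminates. By additivity, multiplicativity reduces to single terms.
\<close>

lemma mpoly_eval_hom: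
  assumes h: "unital_hom h"
  shows "unital_hom (mpoly_eval h g)"
proof
  show "mpoly_eval h g 1 = 1"
    using mpoly_eval_single[OF h, of g 0 1] by (simp add: unital_hom.one[OF h])
  show "mpoly_eval h g (p + q) = mpoly_eval h g p + mpoly_eval h g q" for p q
    by (rule mpoly_eval_add[OF h])
  show "mpoly_eval h g (p * q) = mpoly_eval h g p * mpoly_eval h g q" for p q
  proof -
    let ?s = "\<lambda>p m. Poly_Mapping.single m (Poly_Mapping.lookup p m)"
    have decomp: "p = (\<Sum>m\<in>Poly_Mapping.keys p. ?s p m)" for p :: "('d, 'a) mpoly"
      by (rule sum_singles[symmetric])
    have "p * q = (\<Sum>m\<in>Poly_Mapping.keys p. \<Sum>m'\<in>Poly_Mapping.keys q. ?s p m * ?s q m')"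
      by (subst (1) decomp, subst (2) decomp) (simp add: sum_product)
    then have "mpoly_eval h g (p * q) =
        (\<Sum>m\<in>Poly_Mapping.keys p. \<Sum>m'\<in>Poly_Mapping.keys q. mpoly_eval h g (?s p m) * mpoly_eval h g (?s q m'))"
      by (simp add: mpoly_eval_sum[OF h] mult_single mpoly_eval_single[OF h] monom_eval_add
          unital_hom.mult[OF h] ac_simps)
    also have "\<dots> = mpoly_eval h g (\<Sum>m\<in>Poly_Mapping.keys p. ?s p m) * mpoly_eval h g (\<Sum>m\<in>Poly_Mapping.keys q. ?s q m)"
      by (simp only: mpoly_eval_sum[OF h] sum_product)
    finally show ?thesis by (simp only: decomp[symmetric])
  qed
qed

lemma mpoly_eval_mconst:
  assumes "unital_hom h"
  shows "mpoly_eval h g (mconst c) = h c"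
  by (simp add: mconst_def mpoly_eval_single[OF assms])

lemma mpoly_eval_mmonom:
  assumes "unital_hom h"
  shows "mpoly_eval h g (mmonom m) = monom_eval g m"
  by (simp add: mmonom_def mpoly_eval_single[OF assms] unital_hom.one[OF assms])

lemma mpoly_eval_mvar:
  assumes "unital_hom h"
  shows "mpoly_eval h g (mvar v) = g v"
  by (simp add: mvar_def mpoly_eval_mmonom[OF assms])

text \<open>
  Multiplication by a monomial only relabels the coefficients, so it is injective over every
  commutative ring. This makes the different charts comparable.
\<close>

lemma mmonom_cancel:
  fixes q :: "('v, 'a::comm_ring_1) mpoly"
  assumes "mmonom m * q = 0"
  shows "q = 0"
proof (rule poly_mapping_eqI)
  fix k
  have "Poly_Mapping.lookup (mmonom m * q) (m + k) = Poly_Mapping.lookup q k"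
  proof -
    have "mmonom m * q = (\<Sum>l\<in>Poly_Mapping.keys q. Poly_Mapping.single (m + l) (Poly_Mapping.lookup q l))"
      by (subst sum_singles[symmetric, of q])
        (simp add: sum_distrib_left mmonom_def mult_single)
    then show ?thesis
      by (simp add: lookup_sum lookup_single when_def in_keys_iff)
  qed
  then show "Poly_Mapping.lookup q k = Poly_Mapping.lookup 0 k" using assms by simp
qed

text \<open>
  This identifies homomorphisms that agree on constants and indeterminates, and also serves for
  existence statements whose witnesses can be combined along sums and products.
\<close>

lemma mpoly_ring_induct [consumes 1, case_names zero one const var add mult]:
  fixes q :: "('v, 'a::comm_ring_1) mpoly"
  assumes q: "q \<in> carrier (mpoly_ring R V)"
    and zero: "0 \<in> R" and one: "1 \<in> R"
    and const: "\<And>c. c \<in> R \<Longrightarrow> P (mconst c)"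
    and var: "\<And>v. v \<in> V \<Longrightarrow> P (mvar v)"
    and add: "\<And>p q. P p \<Longrightarrow> P q \<Longrightarrow> P (p + q)"
    and mult: "\<And>p q. P p \<Longrightarrow> P q \<Longrightarrow> P (p * q)"
  shows "P q"
proof -
  have P0: "P 0" and P1: "P 1"
    using const[OF zero] const[OF one]
    by (simp_all add: unital_hom.zero[OF mconst_hom] unital_hom.one[OF mconst_hom])
  have Psum: "(\<And>x. x \<in> S \<Longrightarrow> P (f x)) \<Longrightarrow> P (sum f S)" for S :: "('v \<Rightarrow>\<^sub>0 nat) set" and f
    by (induction S rule: infinite_finite_induct) (auto intro: P0 add)
  have Pprod: "(\<And>x. x \<in> S \<Longrightarrow> P (f x)) \<Longrightarrow> P (prod f S)" for S :: "'v set" and f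
    by (induction S rule: infinite_finite_induct) (auto intro: P1 mult)
  have Ppower: "P p \<Longrightarrow> P (p ^ k)" for p k
    by (induction k) (auto intro: P1 mult)
  have "P (Poly_Mapping.single m (Poly_Mapping.lookup q m))" if m: "m \<in> Poly_Mapping.keys q" for m
  proof -
    have c: "Poly_Mapping.lookup q m \<in> R" and k: "Poly_Mapping.keys m \<subseteq> V"
      using q m by (auto simp: mpoly_ring_def)
    have "P (mconst (Poly_Mapping.lookup q m) * monom_eval mvar m)"
      unfolding monom_eval_def by (intro mult const c Pprod Ppower var) (use k in auto)
    then show ?thesis by (simp add: monom_eval_mvar mconst_mult_mmonom)
  qed
  then have "P (\<Sum>m\<in>Poly_Mapping.keys q. Poly_Mapping.single m (Poly_Mapping.lookup q m))"
    by (rule Psum)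
  then show ?thesis by (simp add: sum_singles)
qed

lemma mpoly_eval_mconst_mvar: "mpoly_eval mconst mvar q = q"
  by (simp add: mpoly_eval_superset[OF mconst_hom finite_keys order_refl] monom_eval_mvar
      mconst_mult_mmonom sum_singles)

lemma monom_eval_zero:
  assumes "m \<noteq> 0" "\<And>v. v \<in> Poly_Mapping.keys m \<Longrightarrow> g v = 0"
  shows "monom_eval g m = 0"
proof -
  obtain v where v: "v \<in> Poly_Mapping.keys m" using assms(1) by fastforce
  then have "g v ^ Poly_Mapping.lookup m v = 0"
    using assms(2)[OF v] by (simp add: in_keys_iff zero_power)
  then show ?thesis unfolding monom_eval_def using v by (metis finite_keys prod_zero)
qed

text \<open>
  For polynomials without constant term this is vanishing at common zeros; in general it exhibits
  the constant term as the value of an evaluation homomorphism.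
\<close>

lemma mpoly_eval_vanishing:
  assumes h: "unital_hom h" and q: "q \<in> carrier (mpoly_ring R V)"
    and g: "\<And>v. v \<in> V \<Longrightarrow> g v = 0"
  shows "mpoly_eval h g q = h (Poly_Mapping.lookup q 0)"
proof -
  have "mpoly_eval h g q = (\<Sum>m\<in>insert 0 (Poly_Mapping.keys q). h (Poly_Mapping.lookup q m) * monom_eval g m)"
    by (rule mpoly_eval_superset[OF h]) auto
  also have "\<dots> = (\<Sum>m\<in>insert 0 (Poly_Mapping.keys q). if m = 0 then h (Poly_Mapping.lookup q 0) else 0)"
  proof (rule sum.cong[OF refl])
    fix m assume "m \<in> insert 0 (Poly_Mapping.keys q)"
    then have "Poly_Mapping.keys m \<subseteq> V" using q by (auto simp: mpoly_ring_def)
    then have "monom_eval g m = 0" if "m \<noteq> 0" using monom_eval_zero[OF that] g by blast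
    then show "h (Poly_Mapping.lookup q m) * monom_eval g m = (if m = 0 then h (Poly_Mapping.lookup q 0) else 0)"
      by simp
  qed
  also have "\<dots> = h (Poly_Mapping.lookup q 0)" by simp
  finally show ?thesis .
qed

section \<open>Polynomial rings over a subring of the coefficients\<close>

definition unital_subring :: "'a::comm_ring_1 set \<Rightarrow> bool"
  where "unital_subring R \<longleftrightarrow> 1 \<in> R \<and> (\<forall>x\<in>R. \<forall>y\<in>R. x - y \<in> R \<and> x * y \<in> R)"

lemma unital_subringD:
  assumes "unital_subring R"
  shows "1 \<in> R" "0 \<in> R" "x \<in> R \<Longrightarrow> y \<in> R \<Longrightarrow> x - y \<in> R" "x \<in> R \<Longrightarrow> y \<in> R \<Longrightarrow> x * y \<in> R"
    "x \<in> R \<Longrightarrow> - x \<in> R" "x \<in> R \<Longrightarrow> y \<in> R \<Longrightarrow> x + y \<in> R"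
proof -
  have diff: "x - y \<in> R" if "x \<in> R" "y \<in> R" for x y
    using assms that by (simp add: unital_subring_def)
  show 1: "1 \<in> R" using assms by (simp add: unital_subring_def)
  show 0: "0 \<in> R" using diff[OF 1 1] by simp
  have neg: "- x \<in> R" if "x \<in> R" for x using diff[OF 0 that] by simp
  show "x - y \<in> R" if "x \<in> R" "y \<in> R" using that by (rule diff)
  show "x * y \<in> R" if "x \<in> R" "y \<in> R"
    using assms that by (simp add: unital_subring_def)
  show "- x \<in> R" if "x \<in> R" using that by (rule neg)
  show "x + y \<in> R" if "x \<in> R" "y \<in> R" using diff[OF that(1) neg[OF that(2)]] by simp
qed

lemma unital_subring_sum:
  "unital_subring R \<Longrightarrow> (\<And>x. x \<in> S \<Longrightarrow> f x \<in> R) \<Longrightarrow> sum f S \<in> R"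
  by (induction S rule: infinite_finite_induct) (auto simp: unital_subringD)

lemma unital_subring_prod:
  "unital_subring R \<Longrightarrow> (\<And>x. x \<in> S \<Longrightarrow> f x \<in> R) \<Longrightarrow> prod f S \<in> R"
  by (induction S rule: infinite_finite_induct) (auto simp: unital_subringD)

lemma unital_subring_power:
  "unital_subring R \<Longrightarrow> x \<in> R \<Longrightarrow> x ^ k \<in> R"
  by (induction k) (auto simp: unital_subringD)

lemma single_in_mpoly_ring:
  assumes "c \<in> R" "Poly_Mapping.keys m \<subseteq> V"
  shows "Poly_Mapping.single m c \<in> carrier (mpoly_ring R V)"
  using assms by (auto simp: mpoly_ring_def)

text \<open>
  Closure under products is checked on single terms and extended bilinearly, which avoids describing
  the coefficients of a product.
\<close>

lemma unital_subring_mpoly_ring: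
  fixes R :: "'a::comm_ring_1 set" and V :: "'v set"
  assumes R: "unital_subring R"
  shows "unital_subring (carrier (mpoly_ring R V))"
proof -
  let ?C = "carrier (mpoly_ring R V)"
  note D = unital_subringD[OF R]
  have mem: "p \<in> ?C \<longleftrightarrow> (\<forall>m. Poly_Mapping.lookup p m \<in> R \<and>
      (\<not> Poly_Mapping.keys m \<subseteq> V \<longrightarrow> Poly_Mapping.lookup p m = 0))" for p
    using D(2) unfolding mpoly_ring_def by (force simp: in_keys_iff)
  have add: "p + q \<in> ?C" if "p \<in> ?C" "q \<in> ?C" for p q
    using that unfolding mem by (auto simp: lookup_add D)
  have diff: "p - q \<in> ?C" if "p \<in> ?C" "q \<in> ?C" for p q
    using that unfolding mem by (auto simp: lookup_minus D)
  have sums: "sum f S \<in> ?C" if "\<And>x. x \<in> S \<Longrightarrow> f x \<in> ?C" for f and S :: "('v \<Rightarrow>\<^sub>0 nat) set"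
    using that by (induction S rule: infinite_finite_induct) (auto simp: add, auto simp: mem D)
  have "p * q \<in> ?C" if p: "p \<in> ?C" and q: "q \<in> ?C" for p q
  proof -
    let ?s = "\<lambda>p m. Poly_Mapping.single m (Poly_Mapping.lookup p m)"
    have "?s p m * ?s q m' \<in> ?C" if "m \<in> Poly_Mapping.keys p" "m' \<in> Poly_Mapping.keys q" for m m'
    proof -
      have "Poly_Mapping.keys m \<subseteq> V" "Poly_Mapping.keys m' \<subseteq> V"
        using that p q by (simp_all add: mpoly_ring_def)
      then have "Poly_Mapping.keys (m + m') \<subseteq> V"
        using Poly_Mapping.keys_add[of m m'] by blast
      then show ?thesis
        using that p q by (auto simp: mult_single mem[of p] mem[of q] D intro!: single_in_mpoly_ring)
    qed
    then have "(\<Sum>m\<in>Poly_Mapping.keys p. ?s p m) * (\<Sum>m\<in>Poly_Mapping.keys q. ?s q m) \<in> ?C"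
      unfolding sum_product by (intro sums)
    then show ?thesis by (simp only: sum_singles)
  qed
  moreover have "1 \<in> ?C"
    using single_in_mpoly_ring[of 1 R 0 V] D by simp
  ultimately show ?thesis using diff by (simp add: unital_subring_def)
qed

lemma mpoly_ring_ops [simp]:
  "x \<otimes>\<^bsub>mpoly_ring R V\<^esub> y = x * y" "x \<oplus>\<^bsub>mpoly_ring R V\<^esub> y = x + y"
  "\<one>\<^bsub>mpoly_ring R V\<^esub> = 1" "\<zero>\<^bsub>mpoly_ring R V\<^esub> = 0"
  by (simp_all add: mpoly_ring_def)

lemma cring_mpoly_ring:
  assumes "unital_subring R"
  shows "cring (mpoly_ring R V)"
proof -
  note D = unital_subringD[OF unital_subring_mpoly_ring[OF assms]]
  have "\<exists>q\<in>carrier (mpoly_ring R V). q + p = 0"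
    if "p \<in> carrier (mpoly_ring R V)" for p
    using D(5)[OF that] by (intro bexI[of _ "- p"]) auto
  then show ?thesis
    by (intro cringI abelian_groupI comm_monoidI)
      (use D in \<open>auto simp: algebra_simps\<close>)
qed

lemma mpoly_ring_nat_pow: "x [^]\<^bsub>mpoly_ring R V\<^esub> (k::nat) = x ^ k"
  by (induction k) (simp_all add: nat_pow_def ac_simps)

lemma mconst_in_mpoly_ring: "c \<in> R \<Longrightarrow> mconst c \<in> carrier (mpoly_ring R V)"
  unfolding mconst_def by (rule single_in_mpoly_ring) auto

lemma mmonom_in_mpoly_ring:
  "1 \<in> R \<Longrightarrow> Poly_Mapping.keys m \<subseteq> V \<Longrightarrow> mmonom m \<in> carrier (mpoly_ring R V)"
  unfolding mmonom_def by (rule single_in_mpoly_ring)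

lemma mvar_in_mpoly_ring:
  "1 \<in> R \<Longrightarrow> v \<in> V \<Longrightarrow> mvar v \<in> carrier (mpoly_ring R V)"
  unfolding mvar_def by (rule mmonom_in_mpoly_ring) auto

section \<open>Kernels of localization maps\<close>

text \<open>
  Fractions are classes of \<^const>\<open>loc_rel\<close>. An element \<open>u\<close> annihilating \<open>b\<close> identifies the classes of
  \<open>b/1\<close> and \<open>0/1\<close> because every witness \<open>v\<close> of equality with a fraction \<open>c/t\<close> can be replaced by \<open>uv\<close>.
\<close>

lemma (in cring) loc_frac_eq_zero_iff:
  assumes S: "S \<subseteq> carrier R" "\<one> \<in> S" "\<And>x y. x \<in> S \<Longrightarrow> y \<in> S \<Longrightarrow> x \<otimes> y \<in> S"
    and b: "b \<in> carrier R"
  shows "loc_frac R S b \<one> = loc_frac R S \<zero> \<one> \<longleftrightarrow> (\<exists>u\<in>S. u \<otimes> b = \<zero>)"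
proof
  assume eq: "loc_frac R S b \<one> = loc_frac R S \<zero> \<one>"
  have "(\<zero>, \<one>) \<in> loc_frac R S \<zero> \<one>"
    using S by (auto simp: loc_frac_def loc_rel_def)
  then have "(\<zero>, \<one>) \<in> loc_frac R S b \<one>" by (simp add: eq)
  then obtain u where "u \<in> S" "u \<otimes> (b \<otimes> \<one>) = u \<otimes> (\<zero> \<otimes> \<one>)"
    by (auto simp: loc_frac_def loc_rel_def)
  then show "\<exists>u\<in>S. u \<otimes> b = \<zero>"
    using S b by (intro bexI[of _ u]) auto
next
  assume "\<exists>u\<in>S. u \<otimes> b = \<zero>"
  then obtain u where u: "u \<in> S" "u \<otimes> b = \<zero>" by blast
  have uC: "u \<in> carrier R" using u S by blast
  have same: "(\<exists>v\<in>S. v \<otimes> (b \<otimes> t) = v \<otimes> (c \<otimes> \<one>)) \<longleftrightarrow> (\<exists>v\<in>S. v \<otimes> (\<zero> \<otimes> t) = v \<otimes> (c \<otimes> \<one>))"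
    if t: "t \<in> S" and c: "c \<in> carrier R" for c t
  proof -
    have tC: "t \<in> carrier R" using t S by blast
    have kill: "(u \<otimes> v) \<otimes> (b \<otimes> t) = \<zero>" if "v \<in> carrier R" for v
    proof -
      have "(u \<otimes> v) \<otimes> (b \<otimes> t) = (u \<otimes> b) \<otimes> (v \<otimes> t)"
        using that uC b tC by (simp add: m_ac)
      then show ?thesis using u that tC by simp
    qed
    show ?thesis
    proof
      assume "\<exists>v\<in>S. v \<otimes> (b \<otimes> t) = v \<otimes> (c \<otimes> \<one>)"
      then obtain v where v: "v \<in> S" "v \<otimes> (b \<otimes> t) = v \<otimes> (c \<otimes> \<one>)" by blast
      have vC: "v \<in> carrier R" using v S by blast
      have "(u \<otimes> v) \<otimes> (c \<otimes> \<one>) = u \<otimes> (v \<otimes> (b \<otimes> t))"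
        using v(2) uC vC c by (simp add: m_assoc)
      also have "\<dots> = \<zero>" using kill[OF vC] uC vC b tC by (simp add: m_assoc)
      finally have "(u \<otimes> v) \<otimes> (\<zero> \<otimes> t) = (u \<otimes> v) \<otimes> (c \<otimes> \<one>)" using uC vC tC by simp
      then show "\<exists>v\<in>S. v \<otimes> (\<zero> \<otimes> t) = v \<otimes> (c \<otimes> \<one>)" using S(3) u(1) v(1) by blast
    next
      assume "\<exists>v\<in>S. v \<otimes> (\<zero> \<otimes> t) = v \<otimes> (c \<otimes> \<one>)"
      then obtain v where v: "v \<in> S" "v \<otimes> (\<zero> \<otimes> t) = v \<otimes> (c \<otimes> \<one>)" by blast
      have vC: "v \<in> carrier R" using v S by blast
      have "v \<otimes> c = \<zero>" using v(2) vC tC c by simp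
      then have "(u \<otimes> v) \<otimes> (b \<otimes> t) = (u \<otimes> v) \<otimes> (c \<otimes> \<one>)"
        using kill[OF vC] uC vC c by (simp add: m_assoc)
      then show "\<exists>v\<in>S. v \<otimes> (b \<otimes> t) = v \<otimes> (c \<otimes> \<one>)" using S(3) u(1) v(1) by blast
    qed
  qed
  have members: "loc_frac R S x \<one> = {(c, t). c \<in> carrier R \<and> t \<in> S \<and>
      (\<exists>v\<in>S. v \<otimes> (x \<otimes> t) = v \<otimes> (c \<otimes> \<one>))}" if "x \<in> carrier R" for x
    using that S(2) unfolding loc_frac_def loc_rel_def by blast
  show "loc_frac R S b \<one> = loc_frac R S \<zero> \<one>"
    unfolding members[OF b] members[OF zero_closed]
    by (intro Collect_cong) (simp only: same split: prod.splits cong: conj_cong)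
qed

lemma zero_localization: "\<zero>\<^bsub>localization R S\<^esub> = loc_frac R S \<zero>\<^bsub>R\<^esub> \<one>\<^bsub>R\<^esub>"
  by (simp add: localization_def)

lemma zero_product_ring: "\<zero>\<^bsub>product_ring I R\<^esub> = (\<lambda>i\<in>I. \<zero>\<^bsub>R i\<^esub>)"
  by (simp add: product_ring_def)

lemma (in ideal) rcos_zero_iff:
  assumes "x \<in> carrier R"
  shows "I +> x = \<zero>\<^bsub>R Quot I\<^esub> \<longleftrightarrow> x \<in> I"
  using assms a_rcos_zero[OF ideal_axioms] a_rcos_self[OF assms] by (auto simp: FactRing_def)

section \<open>Inertia forms as torsion modulo the ideal of the generic polynomials\<close>

lemma unital_subring_ring_A: "unital_subring (carrier (ring_A s n r d))"
  unfolding ring_A_def by (rule unital_subring_mpoly_ring) (simp add: unital_subring_def)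

lemma unital_subring_ring_C: "unital_subring (carrier (ring_C s n r d))"
  unfolding ring_C_def by (rule unital_subring_mpoly_ring[OF unital_subring_ring_A])

lemma cring_C: "cring (ring_C s n r d)"
  unfolding ring_C_def by (rule cring_mpoly_ring[OF unital_subring_ring_A])

lemma gen_poly_in_C:
  assumes "i \<in> {1..r}"
  shows "gen_poly s n d i \<in> carrier (ring_C s n r d)"
  unfolding gen_poly_def mconst_mult_mmonom
proof (rule unital_subring_sum[OF unital_subring_ring_C])
  fix m assume m: "m \<in> multi_exps s n (d i)"
  have "(i, m) \<in> U_vars s n r d" using assms m by (simp add: U_vars_def)
  then show "Poly_Mapping.single m (mvar (i, m)) \<in> carrier (ring_C s n r d)"
    using m unfolding ring_C_def ring_A_def
    by (intro single_in_mpoly_ring mvar_in_mpoly_ring) (auto simp: multi_exps_def)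
qed

lemma gen_ideal_ideal: "ideal (gen_ideal s n r d) (ring_C s n r d)"
proof -
  interpret cring "ring_C s n r d" by (rule cring_C)
  show ?thesis unfolding gen_ideal_def
    by (rule genideal_ideal) (use gen_poly_in_C in blast)
qed

lemma gen_poly_in_gen_ideal:
  assumes "i \<in> {1..r}"
  shows "gen_poly s n d i \<in> gen_ideal s n r d"
proof -
  interpret cring "ring_C s n r d" by (rule cring_C)
  have "gen_poly s n d ` {1..r} \<subseteq> gen_ideal s n r d" unfolding gen_ideal_def
    by (rule genideal_self) (use gen_poly_in_C in blast)
  then show ?thesis using assms by blast
qed

lemma gen_ideal_ops:
  assumes "F \<in> gen_ideal s n r d"
  shows "c \<in> carrier (ring_C s n r d) \<Longrightarrow> c * F \<in> gen_ideal s n r d"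
    "G \<in> gen_ideal s n r d \<Longrightarrow> F + G \<in> gen_ideal s n r d" "- F \<in> gen_ideal s n r d"
    "F \<in> carrier (ring_C s n r d)"
proof -
  interpret I: ideal "gen_ideal s n r d" "ring_C s n r d" by (rule gen_ideal_ideal)
  note D = unital_subringD[OF unital_subring_ring_C[of s n r d]]
  show mult: "c * F \<in> gen_ideal s n r d" if "c \<in> carrier (ring_C s n r d)" for c
    using I.I_l_closed[OF assms that] by (simp add: ring_C_def)
  show "F + G \<in> gen_ideal s n r d" if "G \<in> gen_ideal s n r d"
    using additive_subgroup.a_closed[OF I.additive_subgroup_axioms assms that] by (simp add: ring_C_def)
  show "- F \<in> gen_ideal s n r d"
    using mult[OF D(5)[OF D(1)]] by simp
  show "F \<in> carrier (ring_C s n r d)" using assms by (rule I.a_Hcarr)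
qed

lemma zero_in_gen_ideal: "0 \<in> gen_ideal s n r d"
proof -
  interpret I: ideal "gen_ideal s n r d" "ring_C s n r d" by (rule gen_ideal_ideal)
  show ?thesis using additive_subgroup.zero_closed[OF I.additive_subgroup_axioms] by (simp add: ring_C_def)
qed

text \<open>
  The kernel of a homomorphism is an ideal, so it is enough to look at the generators.
\<close>

lemma zero_on_gen_ideal:
  fixes \<Phi> :: "'k::comm_ring_1 cpoly \<Rightarrow> 'b::comm_ring_1"
  assumes \<Phi>: "unital_hom \<Phi>" and gen: "\<And>i. i \<in> {1..r} \<Longrightarrow> \<Phi> (gen_poly s n d i) = 0"
    and F: "F \<in> gen_ideal s n r d"
  shows "\<Phi> F = 0"
proof -
  interpret \<Phi>: unital_hom \<Phi> by (rule \<Phi>)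
  let ?C = "ring_C s n r d :: 'k cpoly ring"
  interpret C: cring ?C by (rule cring_C)
  have ops: "x \<otimes>\<^bsub>?C\<^esub> y = x * y" "x \<oplus>\<^bsub>?C\<^esub> y = x + y" "\<zero>\<^bsub>?C\<^esub> = 0" for x y
    by (simp_all add: ring_C_def)
  note D = unital_subringD[OF unital_subring_ring_C[of s n r d]]
  have inv: "\<ominus>\<^bsub>?C\<^esub> x = - x" if "x \<in> carrier ?C" for x
    by (rule C.minus_equality) (use that D(5) in \<open>auto simp: ops\<close>)
  let ?K = "{c \<in> carrier ?C. \<Phi> c = 0}"
  have "ideal ?K ?C"
  proof (rule idealI)
    show "ring ?C" by (rule C.ring_axioms)
    show "subgroup ?K (add_monoid ?C)"
    proof (rule C.add.subgroupI)
      show "?K \<subseteq> carrier ?C" by blast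
      show "?K \<noteq> {}" using D(2) by force
      show "\<ominus>\<^bsub>?C\<^esub> x \<in> ?K" if "x \<in> ?K" for x
        using that D(5) \<Phi>.diff[of 0 x] by (auto simp: inv)
      show "x \<oplus>\<^bsub>?C\<^esub> y \<in> ?K" if "x \<in> ?K" "y \<in> ?K" for x y
        using that D(6) by (auto simp: ops \<Phi>.add)
    qed
  qed (auto simp: ops \<Phi>.mult D)
  then have "gen_ideal s n r d \<subseteq> ?K"
    unfolding gen_ideal_def by (rule C.genideal_minimal) (use gen gen_poly_in_C in blast)
  then show ?thesis using F by blast
qed

lemma sigma_in_C:
  assumes "\<And>j. j \<in> {1..s} \<Longrightarrow> \<iota> j \<in> {1..n j + 1}"
  shows "sigma s \<iota> \<in> carrier (ring_C s n r d)"
  unfolding sigma_def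
proof (rule unital_subring_prod[OF unital_subring_ring_C])
  fix j assume "j \<in> {1..s}"
  then show "mvar (j, \<iota> j) \<in> carrier (ring_C s n r d)"
    unfolding ring_C_def using assms unital_subringD[OF unital_subring_ring_A]
    by (intro mvar_in_mpoly_ring) (auto simp: X_vars_def)
qed

text \<open>
  The form in which inertia forms are used: all quotients, localizations and the product ring are
  traded for multiplication by powers of the \<open>\<sigma>\<close>'s.
\<close>

lemma inertia_forms_iff:
  fixes c :: "'k::comm_ring_1 cpoly"
  shows "c \<in> inertia_forms s n r d \<longleftrightarrow> c \<in> carrier (ring_C s n r d) \<and>
     (\<forall>\<iota>\<in>sigma_index s n. \<exists>N. sigma s \<iota> ^ N * c \<in> gen_ideal s n r d)"
proof (cases "c \<in> carrier (ring_C s n r d)")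
  case c: True
  let ?C = "ring_C s n r d :: 'k cpoly ring" and ?I = "gen_ideal s n r d :: 'k cpoly set"
  let ?B = "ring_B s n r d :: 'k cpoly set ring"
  let ?p = "proj_B s n r d :: 'k cpoly \<Rightarrow> 'k cpoly set"
  interpret C: cring ?C by (rule cring_C)
  interpret I: ideal ?I ?C by (rule gen_ideal_ideal)
  have p_eq: "?p = (+>\<^bsub>?C\<^esub>) ?I" by (simp add: proj_B_def fun_eq_iff)
  interpret p: ring_hom_ring ?C ?B ?p
    unfolding p_eq ring_B_def by (rule I.rcos_ring_hom_ring)
  interpret B: cring ?B
    unfolding ring_B_def by (rule I.quotient_is_cring[OF cring_C])
  have p_zero: "?p x = \<zero>\<^bsub>?B\<^esub> \<longleftrightarrow> x \<in> ?I" if "x \<in> carrier ?C" for x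
    using I.rcos_zero_iff[OF that] by (simp add: proj_B_def ring_B_def)
  have pow: "x [^]\<^bsub>?C\<^esub> k = x ^ k" for x and k :: nat
    by (simp add: ring_C_def mpoly_ring_nat_pow)
  have mult: "x \<otimes>\<^bsub>?C\<^esub> y = x * y" for x y by (simp add: ring_C_def)
  have "loc_frac ?B (sigma_powers s n r d \<iota>) (?p c) \<one>\<^bsub>?B\<^esub> = loc_frac ?B (sigma_powers s n r d \<iota>) \<zero>\<^bsub>?B\<^esub> \<one>\<^bsub>?B\<^esub>
      \<longleftrightarrow> (\<exists>N. sigma s \<iota> ^ N * c \<in> ?I)" if \<iota>: "\<iota> \<in> sigma_index s n" for \<iota>
  proof -
    have \<sigma>: "sigma s \<iota> \<in> carrier ?C"
      by (rule sigma_in_C) (use \<iota> in \<open>auto simp: sigma_index_def\<close>)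
    have S: "sigma_powers s n r d \<iota> = {?p (sigma s \<iota> ^ N) | N. True}"
      using p.hom_nat_pow[OF \<sigma>] by (simp add: sigma_powers_def powers_def pow)
    have \<sigma>N: "sigma s \<iota> ^ N \<in> carrier ?C" for N
      using \<sigma> unital_subring_power[OF unital_subring_ring_C] by blast
    have "loc_frac ?B (sigma_powers s n r d \<iota>) (?p c) \<one>\<^bsub>?B\<^esub> = loc_frac ?B (sigma_powers s n r d \<iota>) \<zero>\<^bsub>?B\<^esub> \<one>\<^bsub>?B\<^esub>
      \<longleftrightarrow> (\<exists>u\<in>sigma_powers s n r d \<iota>. u \<otimes>\<^bsub>?B\<^esub> ?p c = \<zero>\<^bsub>?B\<^esub>)"
    proof (rule B.loc_frac_eq_zero_iff)
      show "sigma_powers s n r d \<iota> \<subseteq> carrier ?B" using S \<sigma>N by auto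
      have "?p (sigma s \<iota> ^ 0) = \<one>\<^bsub>?B\<^esub>" using p.hom_one by (simp add: ring_C_def)
      then show "\<one>\<^bsub>?B\<^esub> \<in> sigma_powers s n r d \<iota>" unfolding S by (metis (mono_tags, lifting) mem_Collect_eq)
      show "x \<otimes>\<^bsub>?B\<^esub> y \<in> sigma_powers s n r d \<iota>"
        if xy: "x \<in> sigma_powers s n r d \<iota>" "y \<in> sigma_powers s n r d \<iota>" for x y
      proof -
        obtain M N where "x = ?p (sigma s \<iota> ^ M)" "y = ?p (sigma s \<iota> ^ N)"
          using xy S by auto
        then have "x \<otimes>\<^bsub>?B\<^esub> y = ?p (sigma s \<iota> ^ (M + N))"
          using p.hom_mult[OF \<sigma>N \<sigma>N] by (simp add: mult power_add)
        then show ?thesis using S by auto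
      qed
      show "?p c \<in> carrier ?B" using c by simp
    qed
    also have "\<dots> \<longleftrightarrow> (\<exists>N. ?p (sigma s \<iota> ^ N * c) = \<zero>\<^bsub>?B\<^esub>)"
      using p.hom_mult[OF \<sigma>N c] by (auto simp: S mult)
    also have "\<dots> \<longleftrightarrow> (\<exists>N. sigma s \<iota> ^ N * c \<in> ?I)"
      using p_zero unital_subringD(4)[OF unital_subring_ring_C \<sigma>N c] by auto
    finally show ?thesis .
  qed
  moreover have restrict_eq: "restrict f J = restrict g J \<longleftrightarrow> (\<forall>\<iota>\<in>J. f \<iota> = g \<iota>)"
    for f g :: "(nat \<Rightarrow> nat) \<Rightarrow> ('k cpoly set \<times> 'k cpoly set) set" and J
    by (metis restrict_apply' restrict_ext)
  have "c \<in> inertia_forms s n r d \<longleftrightarrow>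
      loc_map s n r d (?p c) = (\<lambda>\<iota>\<in>sigma_index s n. loc_frac ?B (sigma_powers s n r d \<iota>) \<zero>\<^bsub>?B\<^esub> \<one>\<^bsub>?B\<^esub>)"
    unfolding inertia_forms_def a_kernel_def' zero_product_ring B_sigma_def zero_localization
    using c p.hom_closed[OF c] by blast
  ultimately show ?thesis
    unfolding loc_map_def restrict_eq using c by blast
qed (simp add: inertia_forms_def)

section \<open>Charts, dehomogenization and multihomogeneous polynomials\<close>

text \<open>
  In contrast to the elements of \<^const>\<open>sigma_index\<close>, the values outside \<open>{1..s}\<close> are arbitrary; this
  allows \<open>\<lambda>j. n j + 1\<close> as a chart.
\<close>

definition chart :: "nat \<Rightarrow> (nat \<Rightarrow> nat) \<Rightarrow> (nat \<Rightarrow> nat) \<Rightarrow> bool"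
  where "chart s n \<iota> \<longleftrightarrow> (\<forall>j\<in>{1..s}. \<iota> j \<in> {1..n j + 1})"

text \<open>
  Both the position of the pivot coefficient (with \<open>e = d i\<close>) and the powers of \<open>\<sigma>\<close> (with \<open>e\<close>
  constant) are monomials of this shape.
\<close>

definition pivot :: "nat \<Rightarrow> (nat \<Rightarrow> nat) \<Rightarrow> (nat \<Rightarrow> nat) \<Rightarrow> xmonom"
  where "pivot s \<iota> e = (\<Sum>j = 1..s. Poly_Mapping.single (j, \<iota> j) (e j))"

lemma lookup_pivot:
  "Poly_Mapping.lookup (pivot s \<iota> e) (j, l) = (if j \<in> {1..s} \<and> l = \<iota> j then e j else 0)"
proof -
  have "Poly_Mapping.lookup (pivot s \<iota> e) (j, l) = (\<Sum>j' = 1..s. if j' = j then (if l = \<iota> j then e j else 0) else 0)"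
    unfolding pivot_def lookup_sum
    by (rule sum.cong) (auto simp: lookup_single when_def)
  then show ?thesis by simp
qed

lemma keys_pivot: "chart s n \<iota> \<Longrightarrow> Poly_Mapping.keys (pivot s \<iota> e) \<subseteq> X_vars s n"
  by (auto simp: in_keys_iff lookup_pivot X_vars_def chart_def split: if_splits)

lemma pivot_in_multi_exps: "chart s n \<iota> \<Longrightarrow> pivot s \<iota> e \<in> multi_exps s n e"
  using keys_pivot[of s n \<iota> e] by (auto simp: multi_exps_def lookup_pivot chart_def)

lemma pivot_add: "pivot s \<iota> (\<lambda>j. e j + e' j) = pivot s \<iota> e + pivot s \<iota> e'"
  by (simp add: pivot_def single_add sum.distrib)

lemma multi_exps_add:
  assumes "m \<in> multi_exps s n e" "m' \<in> multi_exps s n e'"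
  shows "m + m' \<in> multi_exps s n (\<lambda>j. e j + e' j)"
  using assms Poly_Mapping.keys_add[of m m'] by (auto simp: multi_exps_def lookup_add sum.distrib simp del: sum.cl_ivl_Suc)

lemma sigma_power: "sigma s \<iota> ^ N = mmonom (pivot s \<iota> (\<lambda>_. N))"
proof -
  have sig: "sigma s \<iota> = mmonom (pivot s \<iota> (\<lambda>_. 1))"
    unfolding sigma_def pivot_def mvar_def
    by (induction s) (simp_all add: mmonom_0 mmonom_add mult.commute add.commute)
  show ?thesis
  proof (induction N)
    case 0
    then show ?case by (simp add: pivot_def mmonom_0)
  next
    case (Suc N)
    then show ?case
      using pivot_add[of s \<iota> "\<lambda>_. 1" "\<lambda>_. N"] by (simp add: sig mmonom_add)
  qed
qed

definition dehom_var :: "(nat \<Rightarrow> nat) \<Rightarrow> nat \<times> nat \<Rightarrow> 'k::comm_ring_1 cpoly"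
  where "dehom_var \<iota> = (\<lambda>(j, l). if l = \<iota> j then 1 else mvar (j, l))"

definition dehom :: "(nat \<Rightarrow> nat) \<Rightarrow> 'k::comm_ring_1 cpoly \<Rightarrow> 'k cpoly"
  where "dehom \<iota> = mpoly_eval mconst (dehom_var \<iota>)"

lemma dehom_hom: "unital_hom (dehom \<iota>)"
  unfolding dehom_def by (rule mpoly_eval_hom[OF mconst_hom])

lemma dehom_mconst: "dehom \<iota> (mconst a) = mconst a"
  unfolding dehom_def by (rule mpoly_eval_mconst[OF mconst_hom])

lemma dehom_mmonom: "dehom \<iota> (mmonom m) = monom_eval (dehom_var \<iota>) m"
  unfolding dehom_def by (rule mpoly_eval_mmonom[OF mconst_hom])

lemma monom_eval_dehom_var_pivot:
  "monom_eval (dehom_var \<iota>) (pivot s \<iota> e) = (1 :: 'k::comm_ring_1 cpoly)"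
  unfolding pivot_def
  by (induction s) (simp_all add: monom_eval_add dehom_var_def)

text \<open>The exponents of the image of the monomial \<open>m\<close> under \<^term>\<open>dehom \<iota>\<close>.\<close>

definition residual :: "(nat \<Rightarrow> nat) \<Rightarrow> xmonom \<Rightarrow> xmonom"
  where "residual \<iota> m =
    (\<Sum>(j, l)\<in>Poly_Mapping.keys m. Poly_Mapping.single (j, l) (if l = \<iota> j then 0 else Poly_Mapping.lookup m (j, l)))"

lemma lookup_residual:
  "Poly_Mapping.lookup (residual \<iota> m) (j, l) = (if l = \<iota> j then 0 else Poly_Mapping.lookup m (j, l))"
proof -
  have "Poly_Mapping.lookup (residual \<iota> m) (j, l) = (\<Sum>x\<in>Poly_Mapping.keys m.
     if x = (j, l) then (if l = \<iota> j then 0 else Poly_Mapping.lookup m (j, l)) else 0)"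
    unfolding residual_def lookup_sum
    by (rule sum.cong) (auto simp: lookup_single when_def split: prod.splits)
  then show ?thesis by (simp add: in_keys_iff)
qed

lemma monom_eval_dehom_var:
  "monom_eval (dehom_var \<iota>) m = (mmonom (residual \<iota> m) :: 'k::comm_ring_1 cpoly)"
  unfolding monom_eval_def residual_def mmonom_sum
  by (rule prod.cong) (auto simp: dehom_var_def mvar_power mmonom_0)

text \<open>
  The exponent that was forgotten in packet \<open>j\<close> is \<open>e j\<close> minus the other exponents of that packet.
\<close>

lemma residual_inj:
  assumes m: "m \<in> multi_exps s n e" and m': "m' \<in> multi_exps s n e"
    and eq: "residual \<iota> m = residual \<iota> m'" and \<iota>: "chart s n \<iota>"
  shows "m = m'"
proof (rule poly_mapping_eqI)
  fix x :: "nat \<times> nat"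
  obtain j l where x: "x = (j, l)" by force
  have off: "Poly_Mapping.lookup m (j, l) = Poly_Mapping.lookup m' (j, l)" if "l \<noteq> \<iota> j" for l
    using lookup_residual[of \<iota> m j l] lookup_residual[of \<iota> m' j l] eq that by simp
  show "Poly_Mapping.lookup m x = Poly_Mapping.lookup m' x"
  proof (cases "x \<in> X_vars s n \<and> l = \<iota> j")
    case True
    then have j: "j \<in> {1..s}" and l: "\<iota> j \<in> {1..n j + 1}" using x by (auto simp: X_vars_def)
    have "(\<Sum>l = 1..n j + 1. Poly_Mapping.lookup m (j, l)) = (\<Sum>l = 1..n j + 1. Poly_Mapping.lookup m' (j, l))"
      using m m' j by (simp add: multi_exps_def)
    moreover have "(\<Sum>l\<in>{1..n j + 1} - {\<iota> j}. Poly_Mapping.lookup m (j, l)) =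
        (\<Sum>l\<in>{1..n j + 1} - {\<iota> j}. Poly_Mapping.lookup m' (j, l))"
      by (rule sum.cong) (auto simp: off)
    ultimately have "Poly_Mapping.lookup m (j, \<iota> j) = Poly_Mapping.lookup m' (j, \<iota> j)"
      using sum.remove[OF finite_atLeastAtMost l, of "\<lambda>l. Poly_Mapping.lookup m (j, l)"]
        sum.remove[OF finite_atLeastAtMost l, of "\<lambda>l. Poly_Mapping.lookup m' (j, l)"] by linarith
    then show ?thesis using True x by simp
  next
    case False
    then consider "l \<noteq> \<iota> j" | "x \<notin> X_vars s n" by blast
    then show ?thesis
    proof cases
      case 1
      then show ?thesis using off x by simp
    next
      case 2
      then have "x \<notin> Poly_Mapping.keys m" "x \<notin> Poly_Mapping.keys m'"
        using m m' by (auto simp: multi_exps_def)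
      then show ?thesis by (simp add: in_keys_iff)
    qed
  qed
qed

definition multihomogeneous ::
  "nat \<Rightarrow> (nat \<Rightarrow> nat) \<Rightarrow> (nat \<Rightarrow> nat) \<Rightarrow> 'k::comm_ring_1 cpoly \<Rightarrow> bool"
  where "multihomogeneous s n e G \<longleftrightarrow> Poly_Mapping.keys G \<subseteq> multi_exps s n e"

text \<open>
  On a multihomogeneous polynomial dehomogenization maps distinct monomials to distinct
  monomials, so nothing can cancel.
\<close>

lemma multihomogeneous_dehom_eq_zero:
  assumes G: "multihomogeneous s n e G" and \<iota>: "chart s n \<iota>" and zero: "dehom \<iota> G = 0"
  shows "G = 0"
proof (rule poly_mapping_eqI)
  fix m
  have "dehom \<iota> G = (\<Sum>k\<in>Poly_Mapping.keys G. Poly_Mapping.single (residual \<iota> k) (Poly_Mapping.lookup G k))"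
    by (simp add: dehom_def mpoly_eval_superset[OF mconst_hom finite_keys order_refl]
        monom_eval_dehom_var mconst_mult_mmonom)
  then have *: "(\<Sum>k\<in>Poly_Mapping.keys G. Poly_Mapping.lookup
      (Poly_Mapping.single (residual \<iota> k) (Poly_Mapping.lookup G k)) (residual \<iota> m)) = 0"
    unfolding lookup_sum[symmetric] using zero by simp
  show "Poly_Mapping.lookup G m = Poly_Mapping.lookup 0 m"
  proof (cases "m \<in> Poly_Mapping.keys G")
    case True
    have "(\<Sum>k\<in>Poly_Mapping.keys G. Poly_Mapping.lookup (Poly_Mapping.single (residual \<iota> k) (Poly_Mapping.lookup G k)) (residual \<iota> m))
       = (\<Sum>k\<in>Poly_Mapping.keys G. if k = m then Poly_Mapping.lookup G m else 0)"
      using G True residual_inj[OF _ _ _ \<iota>, of _ e m]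
      by (intro sum.cong) (auto simp: lookup_single when_def multihomogeneous_def)
    then show ?thesis using * True by simp
  qed (simp add: in_keys_iff)
qed

text \<open>
  Degrees are functions on all natural numbers, but only the packets \<open>1, \<dots>, s\<close> count.
\<close>

lemma multihomogeneous_cong:
  "(\<And>j. j \<in> {1..s} \<Longrightarrow> e j = e' j) \<Longrightarrow> multihomogeneous s n e G \<Longrightarrow> multihomogeneous s n e' G"
  unfolding multihomogeneous_def multi_exps_def by auto

lemma multihomogeneous_mult:
  assumes "multihomogeneous s n e G" "multihomogeneous s n e' H"
  shows "multihomogeneous s n (\<lambda>j. e j + e' j) (G * H)"
  using assms keys_mult[of G H] multi_exps_add unfolding multihomogeneous_def by blast

lemma multihomogeneous_add:
  "multihomogeneous s n e G \<Longrightarrow> multihomogeneous s n e H \<Longrightarrow> multihomogeneous s n e (G + H)"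
  using Poly_Mapping.keys_add[of G H] unfolding multihomogeneous_def by blast

lemma multihomogeneous_diff:
  "multihomogeneous s n e G \<Longrightarrow> multihomogeneous s n e H \<Longrightarrow> multihomogeneous s n e (G - H)"
  using keys_diff[of G H] unfolding multihomogeneous_def by blast

lemma multihomogeneous_single:
  "m \<in> multi_exps s n e \<Longrightarrow> multihomogeneous s n e (Poly_Mapping.single m c)"
  by (auto simp: multihomogeneous_def)

lemma multihomogeneous_gen_poly: "multihomogeneous s n (d i) (gen_poly s n d i)"
  unfolding multihomogeneous_def gen_poly_def mconst_mult_mmonom
  by (rule order_trans[OF keys_sum]) auto

lemma dehom_sigma_power: "dehom \<iota> (sigma s \<iota> ^ N) = 1"
  by (simp add: sigma_power dehom_mmonom monom_eval_dehom_var_pivot)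

section \<open>Eliminating the pivot coefficients\<close>

text \<open>
  The substitution \<open>\<epsilon>\<^sub>i \<mapsto> \<epsilon>\<^sub>i - t\<^sub>i\<close> in the pivot coefficients. The shifts \<open>t\<^sub>i\<close> are left open, with
  indeterminates in any type, because two instances occur: the dehomogenized polynomials, which gives
  the elimination, and new indeterminates \<open>T\<^sub>i\<close>, which gives the polynomial \<open>Q\<close> of Perrin's formula.
\<close>

definition shift_coeff ::
  "nat \<Rightarrow> (nat \<Rightarrow> nat \<Rightarrow> nat) \<Rightarrow> (nat \<Rightarrow> nat) \<Rightarrow> (nat \<Rightarrow> ('v, 'k apoly) mpoly) \<Rightarrow>
    'k::comm_ring_1 apoly \<Rightarrow> ('v, 'k apoly) mpoly"
  where "shift_coeff s d \<iota> t = mpoly_eval (\<lambda>c. mconst (mconst c))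
    (\<lambda>(i, m). mconst (mvar (i, m)) - (if m = pivot s \<iota> (d i) then t i else 0))"

lemma mconst_mconst_hom: "unital_hom (\<lambda>c. mconst (mconst c))"
  by (rule unital_hom_compose[OF mconst_hom mconst_hom])

lemma shift_coeff_hom: "unital_hom (shift_coeff s d \<iota> t)"
  unfolding shift_coeff_def by (rule mpoly_eval_hom[OF mconst_mconst_hom])

lemma shift_coeff_mconst: "shift_coeff s d \<iota> t (mconst c) = mconst (mconst c)"
  unfolding shift_coeff_def by (rule mpoly_eval_mconst[OF mconst_mconst_hom])

lemma shift_coeff_mvar: "shift_coeff s d \<iota> t (mvar (i, m)) =
    mconst (mvar (i, m)) - (if m = pivot s \<iota> (d i) then t i else 0)"
  unfolding shift_coeff_def by (subst mpoly_eval_mvar[OF mconst_mconst_hom]) simp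

text \<open>
  The map \<open>\<psi>\<close> of the introduction. Its extension \<open>elim_poly\<close> to \<open>C\<close> sets the variables
  of the chart to \<open>1\<close>.
\<close>

definition elim_coeff ::
  "nat \<Rightarrow> (nat \<Rightarrow> nat) \<Rightarrow> (nat \<Rightarrow> nat \<Rightarrow> nat) \<Rightarrow> (nat \<Rightarrow> nat) \<Rightarrow> 'k::comm_ring_1 apoly \<Rightarrow> 'k cpoly"
  where "elim_coeff s n d \<iota> = shift_coeff s d \<iota> (\<lambda>i. dehom \<iota> (gen_poly s n d i))"

definition elim_poly ::
  "nat \<Rightarrow> (nat \<Rightarrow> nat) \<Rightarrow> (nat \<Rightarrow> nat \<Rightarrow> nat) \<Rightarrow> (nat \<Rightarrow> nat) \<Rightarrow> 'k::comm_ring_1 cpoly \<Rightarrow> 'k cpoly"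
  where "elim_poly s n d \<iota> = mpoly_eval (elim_coeff s n d \<iota>) (dehom_var \<iota>)"

lemma elim_coeff_hom: "unital_hom (elim_coeff s n d \<iota>)"
  unfolding elim_coeff_def by (rule shift_coeff_hom)

lemma elim_poly_hom: "unital_hom (elim_poly s n d \<iota>)"
  unfolding elim_poly_def by (rule mpoly_eval_hom[OF elim_coeff_hom])

lemma elim_poly_mconst: "elim_poly s n d \<iota> (mconst a) = elim_coeff s n d \<iota> a"
  unfolding elim_poly_def by (rule mpoly_eval_mconst[OF elim_coeff_hom])

lemma elim_poly_mmonom: "elim_poly s n d \<iota> (mmonom m) = monom_eval (dehom_var \<iota>) m"
  unfolding elim_poly_def by (rule mpoly_eval_mmonom[OF elim_coeff_hom])

lemma dehom_gen_poly:
  "dehom \<iota> (gen_poly s n d i) =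
    (\<Sum>m \<in> multi_exps s n (d i). mconst (mvar (i, m)) * monom_eval (dehom_var \<iota>) m)"
  unfolding gen_poly_def
  by (simp add: unital_hom.hom_sum[OF dehom_hom] unital_hom.mult[OF dehom_hom] dehom_mconst dehom_mmonom)

text \<open>
  Elimination subtracts the dehomogenization \<open>F\<^sub>i\<close> of \<open>f\<^sub>i\<close> once, at the pivot monomial, which itself
  becomes \<open>1\<close>. What remains of \<open>f\<^sub>i\<close> is \<open>F\<^sub>i - F\<^sub>i\<close>.
\<close>

lemma elim_poly_gen_poly:
  assumes "chart s n \<iota>"
  shows "elim_poly s n d \<iota> (gen_poly s n d i) = 0"
proof -
  let ?F = "dehom \<iota> (gen_poly s n d i)"
  have "elim_poly s n d \<iota> (gen_poly s n d i) = (\<Sum>m \<in> multi_exps s n (d i).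
      (mconst (mvar (i, m)) - (if m = pivot s \<iota> (d i) then ?F else 0)) * monom_eval (dehom_var \<iota>) m)"
    by (subst (1) gen_poly_def)
      (simp add: unital_hom.hom_sum[OF elim_poly_hom] unital_hom.mult[OF elim_poly_hom]
        elim_poly_mconst elim_poly_mmonom elim_coeff_def shift_coeff_mvar)
  also have "\<dots> = ?F - (\<Sum>m \<in> multi_exps s n (d i).
      if m = pivot s \<iota> (d i) then ?F * monom_eval (dehom_var \<iota>) m else 0)"
    unfolding dehom_gen_poly[of \<iota> s n d i] sum_subtractf[symmetric]
    by (rule sum.cong) (auto simp: left_diff_distrib)
  also have "\<dots> = 0"
    using pivot_in_multi_exps[OF assms, of "d i"]
    by (simp add: finite_multi_exps monom_eval_dehom_var_pivot)
  finally show ?thesis .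
qed

lemma elim_poly_dehom:
  fixes G :: "'k::comm_ring_1 cpoly"
  shows "elim_poly s n d \<iota> (dehom \<iota> G) = elim_poly s n d \<iota> G"
proof -
  have hom: "unital_hom (\<lambda>G :: 'k cpoly. elim_poly s n d \<iota> (dehom \<iota> G))"
    by (rule unital_hom_compose[OF elim_poly_hom dehom_hom])
  have "G \<in> carrier (mpoly_ring UNIV UNIV)" by (simp add: mpoly_ring_def)
  then show ?thesis
  proof (induction G rule: mpoly_ring_induct)
    case (var v)
    obtain j l where v: "v = (j, l)" by force
    have "dehom \<iota> (mvar v) = (dehom_var \<iota> v :: 'k cpoly)"
      by (simp add: dehom_def mpoly_eval_mvar[OF mconst_hom])
    moreover have "elim_poly s n d \<iota> (mvar v) = (dehom_var \<iota> v :: 'k cpoly)"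
      by (simp add: elim_poly_def mpoly_eval_mvar[OF elim_coeff_hom])
    ultimately show ?case
      by (simp add: dehom_var_def v unital_hom.one[OF elim_poly_hom] split: if_splits)
  qed (simp_all add: dehom_mconst unital_hom.add[OF hom] unital_hom.add[OF elim_poly_hom]
      unital_hom.mult[OF hom] unital_hom.mult[OF elim_poly_hom])
qed

section \<open>The resultant ideal as the kernel of the elimination\<close>

lemma multihomogeneous_sigma_power_mult:
  assumes "chart s n \<iota>" "multihomogeneous s n (\<lambda>_. M) G"
  shows "multihomogeneous s n (\<lambda>_. N + M) (sigma s \<iota> ^ N * G)"
  unfolding sigma_power mmonom_def
  by (intro multihomogeneous_mult multihomogeneous_single pivot_in_multi_exps assms)

lemma multihomogeneous_mconst: "multihomogeneous s n (\<lambda>_. 0) (mconst c)"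
  unfolding mconst_def by (rule multihomogeneous_single) (simp add: multi_exps_def)

text \<open>
  In the localization at \<open>\<sigma>\<close>, the substitution \<open>\<epsilon>\<^sub>i \<mapsto> \<epsilon>\<^sub>i - f\<^sub>i / \<sigma>\<^sup>d\<close> (with the appropriate power
  in each packet) takes values of degree \<open>0\<close> and is the identity modulo the \<open>f\<^sub>i\<close>. Here \<open>G\<close> is the
  result of this substitution in \<open>a\<close> with the denominator \<open>\<sigma>\<^sup>N\<close> cleared. Numerators and denominators
  combine as for fractions, which is why the induction over sums and products succeeds.
\<close>

lemma multihomogeneous_lift:
  fixes a :: "'k::comm_ring_1 apoly"
  assumes a: "a \<in> carrier (ring_A s n r d)" and \<iota>: "chart s n \<iota>"
  shows "\<exists>N G. multihomogeneous s n (\<lambda>_. N) G \<and> G \<in> carrier (ring_C s n r d) \<and>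
    G - sigma s \<iota> ^ N * mconst a \<in> gen_ideal s n r d \<and> dehom \<iota> G = elim_coeff s n d \<iota> a"
    (is "\<exists>N G. ?P a N G")
  using a unfolding ring_A_def
proof (induction a rule: mpoly_ring_induct)
  note C = unital_subringD[OF unital_subring_ring_C[of s n r d]]
  note dehom_simps = unital_hom.add[OF dehom_hom] unital_hom.diff[OF dehom_hom]
    unital_hom.mult[OF dehom_hom] dehom_mconst dehom_mmonom dehom_sigma_power
  have \<sigma>C: "sigma s \<iota> ^ N \<in> carrier (ring_C s n r d)" for N
    using \<iota> by (intro unital_subring_power[OF unital_subring_ring_C] sigma_in_C) (simp add: chart_def)
  have constC: "mconst b \<in> carrier (ring_C s n r d)" if "b \<in> carrier (ring_A s n r d)" for b
    unfolding ring_C_def using that by (rule mconst_in_mpoly_ring)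
  {
    case (const c)
    have "mconst c \<in> carrier (ring_A s n r d)" unfolding ring_A_def by (rule mconst_in_mpoly_ring) simp
    then have "?P (mconst c) 0 (mconst (mconst c))"
      by (auto simp: multihomogeneous_mconst constC zero_in_gen_ideal dehom_mconst elim_coeff_def
          shift_coeff_mconst)
    then show ?case by blast
  next
    case (var v)
    obtain i m where v: "v = (i, m)" by force
    have i: "i \<in> {1..r}" using var v by (simp add: U_vars_def)
    have vC: "mconst (mvar v) \<in> carrier (ring_C s n r d)"
      using var by (intro constC) (simp add: ring_A_def mvar_in_mpoly_ring)
    show ?case
    proof (cases "m = pivot s \<iota> (d i)")
      case False
      then have "?P (mvar v) 0 (mconst (mvar v))"
        using vC by (simp add: v multihomogeneous_mconst zero_in_gen_ideal dehom_mconst elim_coeff_def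
            shift_coeff_mvar)
      then show ?thesis by blast
    next
      case True
      \<comment> \<open>Any common upper bound of the degrees \<open>d i j\<close> over the packets would do: multiplying
        \<open>f\<^sub>i\<close> by \<open>?\<mu>\<close> raises its degree to \<open>N\<close> in every packet.\<close>
      define N where "N = (\<Sum>j = 1..s. d i j)"
      let ?\<mu> = "mmonom (pivot s \<iota> (\<lambda>j. N - d i j)) :: 'k cpoly"
      let ?G = "sigma s \<iota> ^ N * mconst (mvar v) - ?\<mu> * gen_poly s n d i"
      have dN: "d i j \<le> N" if "j \<in> {1..s}" for j
        unfolding N_def by (rule member_le_sum) (use that in auto)
      have \<mu>C: "?\<mu> \<in> carrier (ring_C s n r d)"
        unfolding ring_C_def using unital_subringD(1)[OF unital_subring_ring_A] keys_pivot[OF \<iota>]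
        by (rule mmonom_in_mpoly_ring)
      have "multihomogeneous s n (\<lambda>j. (N - d i j) + d i j) (?\<mu> * gen_poly s n d i)"
        unfolding mmonom_def by (intro multihomogeneous_mult multihomogeneous_gen_poly
            multihomogeneous_single pivot_in_multi_exps \<iota>)
      then have "multihomogeneous s n (\<lambda>_. N) (?\<mu> * gen_poly s n d i)"
        by (rule multihomogeneous_cong[rotated]) (simp add: dN)
      moreover have "multihomogeneous s n (\<lambda>_. N) (sigma s \<iota> ^ N * mconst (mvar v))"
        using multihomogeneous_sigma_power_mult[OF \<iota> multihomogeneous_mconst] by simp
      ultimately have "multihomogeneous s n (\<lambda>_. N) ?G" by (rule multihomogeneous_diff[rotated])
      moreover have "?G \<in> carrier (ring_C s n r d)"
        by (intro C(3,4) \<sigma>C vC \<mu>C gen_poly_in_C i)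
      moreover have "?G - sigma s \<iota> ^ N * mconst (mvar v) \<in> gen_ideal s n r d"
        using gen_ideal_ops(3)[OF gen_ideal_ops(1)[OF gen_poly_in_gen_ideal[OF i] \<mu>C]] by simp
      moreover have "dehom \<iota> ?G = elim_coeff s n d \<iota> (mvar v)"
        by (simp add: dehom_simps monom_eval_dehom_var_pivot elim_coeff_def v shift_coeff_mvar True)
      ultimately show ?thesis by blast
    qed
  next
    case (add p q)
    then obtain M G N H where G: "?P p M G" and H: "?P q N H" by blast
    let ?S = "sigma s \<iota> ^ N * G + sigma s \<iota> ^ M * H"
    have "multihomogeneous s n (\<lambda>_. M + N) ?S"
      using multihomogeneous_sigma_power_mult[OF \<iota>, of M G N] G
        multihomogeneous_sigma_power_mult[OF \<iota>, of N H M] H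
      by (intro multihomogeneous_add) (simp_all add: add.commute)
    moreover have "?S \<in> carrier (ring_C s n r d)"
      using G H by (intro C(4,6) \<sigma>C) auto
    moreover have "?S - sigma s \<iota> ^ (M + N) * mconst (p + q) =
        sigma s \<iota> ^ N * (G - sigma s \<iota> ^ M * mconst p) + sigma s \<iota> ^ M * (H - sigma s \<iota> ^ N * mconst q)"
      by (simp add: unital_hom.add[OF mconst_hom] power_add algebra_simps)
    then have "?S - sigma s \<iota> ^ (M + N) * mconst (p + q) \<in> gen_ideal s n r d"
      using G H by (simp add: gen_ideal_ops \<sigma>C)
    moreover have "dehom \<iota> ?S = elim_coeff s n d \<iota> (p + q)"
      using G H by (simp add: dehom_simps unital_hom.add[OF elim_coeff_hom])
    ultimately show ?case by blast
  next
    case (mult p q)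
    then obtain M G N H where G: "?P p M G" and H: "?P q N H" by blast
    let ?u = "G - sigma s \<iota> ^ M * mconst p" and ?v = "H - sigma s \<iota> ^ N * mconst q"
    have "multihomogeneous s n (\<lambda>_. M + N) (G * H)"
      using G H by (intro multihomogeneous_mult) auto
    moreover have "G * H \<in> carrier (ring_C s n r d)" using G H by (simp add: C)
    \<comment> \<open>The factors \<open>G\<close> and \<open>H\<close>, known to lie in \<open>C\<close>, are used in place of \<open>\<sigma>\<^sup>M p\<close> and \<open>\<sigma>\<^sup>N q\<close>;
      this counts the product \<open>?u * ?v\<close> twice.\<close>
    moreover have "G * H - sigma s \<iota> ^ (M + N) * mconst (p * q) = (H * ?u + G * ?v) + - (?u * ?v)"
      by (simp add: unital_hom.mult[OF mconst_hom] power_add algebra_simps)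
    then have "G * H - sigma s \<iota> ^ (M + N) * mconst (p * q) \<in> gen_ideal s n r d"
      using G H gen_ideal_ops(4)[of ?u s n r d] by (simp only: gen_ideal_ops)
    moreover have "dehom \<iota> (G * H) = elim_coeff s n d \<iota> (p * q)"
      using G H by (simp add: dehom_simps unital_hom.mult[OF elim_coeff_hom])
    ultimately show ?case by blast
  }
qed auto

lemma elim_coeff_eq_zero_imp:
  assumes "a \<in> carrier (ring_A s n r d)" "chart s n \<iota>" "elim_coeff s n d \<iota> a = 0"
  shows "\<exists>N. sigma s \<iota> ^ N * mconst a \<in> gen_ideal s n r d"
proof -
  obtain N G where G: "multihomogeneous s n (\<lambda>_. N) G" "dehom \<iota> G = 0"
      "G - sigma s \<iota> ^ N * mconst a \<in> gen_ideal s n r d"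
    using multihomogeneous_lift[OF assms(1,2)] assms(3) by metis
  have "G = 0" by (rule multihomogeneous_dehom_eq_zero[OF G(1) assms(2) G(2)])
  then show ?thesis using gen_ideal_ops(3)[OF G(3)] by auto
qed

text \<open>
  The charts \<open>\<kappa>\<close> and \<open>\<iota>\<close> may differ: in the chart \<open>\<iota>\<close> the power of \<open>\<sigma>\<^sub>\<kappa>\<close> becomes a monomial, which can be
  cancelled.
\<close>

lemma elim_coeff_eq_zero_if:
  assumes F: "sigma s \<kappa> ^ N * mconst a \<in> gen_ideal s n r d" and \<iota>: "chart s n \<iota>"
  shows "elim_coeff s n d \<iota> a = 0"
proof -
  have "elim_poly s n d \<iota> (sigma s \<kappa> ^ N * mconst a) = 0"
    by (rule zero_on_gen_ideal[OF elim_poly_hom elim_poly_gen_poly[OF \<iota>] F])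
  then have "mmonom (residual \<iota> (pivot s \<kappa> (\<lambda>_. N))) * elim_coeff s n d \<iota> a = 0"
    by (simp add: unital_hom.mult[OF elim_poly_hom] sigma_power elim_poly_mmonom elim_poly_mconst
        monom_eval_dehom_var)
  then show ?thesis by (rule mmonom_cancel)
qed

text \<open>
  Membership is a condition on all charts, but vanishing on the single chart \<open>\<kappa>\<close> already implies
  vanishing on all of them, by passing through a relation on \<open>\<kappa>\<close>.
\<close>

lemma resultant_ideal_iff:
  assumes a: "a \<in> carrier (ring_A s n r d)" and \<kappa>: "chart s n \<kappa>"
  shows "a \<in> resultant_ideal s n r d \<longleftrightarrow> elim_coeff s n d \<kappa> a = 0"
proof -
  have "mconst a \<in> carrier (ring_C s n r d)"
    unfolding ring_C_def using a by (rule mconst_in_mpoly_ring)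
  then have iff: "a \<in> resultant_ideal s n r d \<longleftrightarrow>
      (\<forall>\<iota>\<in>sigma_index s n. \<exists>N. sigma s \<iota> ^ N * mconst a \<in> gen_ideal s n r d)"
    using a by (simp add: resultant_ideal_def inertia_forms_iff)
  have "restrict \<kappa> {1..s} \<in> sigma_index s n"
    using \<kappa> by (auto simp: sigma_index_def chart_def)
  moreover have "chart s n \<iota>" if "\<iota> \<in> sigma_index s n" for \<iota>
    using that by (auto simp: sigma_index_def chart_def)
  ultimately show ?thesis
    unfolding iff using elim_coeff_eq_zero_imp[OF a] elim_coeff_eq_zero_if \<kappa> by metis
qed

section \<open>Perrin's formula\<close>

lemma shift_coeff_in_mpoly_ring:
  assumes "a \<in> carrier (ring_A s n r d)"
  shows "shift_coeff s d \<iota> mvar a \<in> carrier (mpoly_ring (carrier (ring_A s n r d)) {1..r})"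
  using assms unfolding ring_A_def
proof (induction a rule: mpoly_ring_induct)
  let ?A = "carrier (mpoly_ring UNIV (U_vars s n r d))"
  have A: "unital_subring ?A" using unital_subring_ring_A by (simp add: ring_A_def)
  note D = unital_subringD[OF unital_subring_mpoly_ring[OF A, of "{1..r}"]]
  {
    case (const c)
    show ?case by (simp add: shift_coeff_mconst mconst_in_mpoly_ring)
  next
    case (var v)
    obtain i m where v: "v = (i, m)" by force
    have "mvar i \<in> carrier (mpoly_ring ?A {1..r})" "mconst (mvar v) \<in> carrier (mpoly_ring ?A {1..r})"
      using var v unital_subringD(1)[OF A]
      by (auto simp: U_vars_def intro!: mvar_in_mpoly_ring mconst_in_mpoly_ring)
    then show ?case
      unfolding v shift_coeff_mvar by (intro D(3)) (use D(2) in auto)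
  next
    case (add p q)
    then show ?case unfolding unital_hom.add[OF shift_coeff_hom] by (rule D(6))
  next
    case (mult p q)
    then show ?case unfolding unital_hom.mult[OF shift_coeff_hom] by (rule D(4))
  }
qed auto

text \<open>
  Substituting values for the shifts \<open>T\<^sub>i\<close> commutes with shifting. The values \<open>F\<^sub>i\<close> recover the
  elimination map, and the values \<open>0\<close> recover \<open>a\<close>, hence the constant term.
\<close>

lemma mpoly_eval_shift_coeff:
  fixes a :: "'k::comm_ring_1 apoly" and h :: "'k apoly \<Rightarrow> 'b::comm_ring_1"
  assumes h: "unital_hom h"
  shows "mpoly_eval h t (shift_coeff s d \<iota> mvar a) =
    mpoly_eval (\<lambda>c. h (mconst c)) (\<lambda>(i, m). h (mvar (i, m)) - (if m = pivot s \<iota> (d i) then t i else 0)) a"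
proof -
  have hc: "unital_hom (\<lambda>c. h (mconst c))" by (rule unital_hom_compose[OF h mconst_hom])
  note E = mpoly_eval_hom[OF h, of t] and E' = mpoly_eval_hom[OF hc]
  have "a \<in> carrier (mpoly_ring UNIV UNIV)" by (simp add: mpoly_ring_def)
  then show ?thesis
  proof (induction a rule: mpoly_ring_induct)
    case (var v)
    obtain i m where v: "v = (i, m)" by force
    show ?case
      unfolding v shift_coeff_mvar
      by (simp add: unital_hom.diff[OF E] mpoly_eval_mconst[OF h] mpoly_eval_mvar[OF h]
          mpoly_eval_mvar[OF hc] unital_hom.zero[OF E])
  qed (simp_all add: unital_hom.add[OF E] unital_hom.add[OF E'] unital_hom.mult[OF E] unital_hom.mult[OF E']
      unital_hom.add[OF shift_coeff_hom] unital_hom.mult[OF shift_coeff_hom] shift_coeff_mconst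
      mpoly_eval_mconst[OF h] mpoly_eval_mconst[OF hc])
qed

lemma lookup_shift_coeff_0: "Poly_Mapping.lookup (shift_coeff s d \<iota> mvar a) 0 = a"
proof -
  have "Poly_Mapping.lookup (shift_coeff s d \<iota> mvar a) 0 = mpoly_eval (\<lambda>c. c) (\<lambda>_. 0) (shift_coeff s d \<iota> mvar a)"
    by (rule mpoly_eval_vanishing[OF unital_hom_id, of _ UNIV UNIV, symmetric]) (simp_all add: mpoly_ring_def)
  also have "\<dots> = mpoly_eval mconst (\<lambda>(i, m). mvar (i, m)) a"
    by (simp add: mpoly_eval_shift_coeff[OF unital_hom_id])
  also have "\<dots> = a" by (simp add: mpoly_eval_mconst_mvar)
  finally show ?thesis .
qed

text \<open>
  The elimination kills the dehomogenized polynomials as well, since they differ from the original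
  ones only by variables that it sends to \<open>1\<close>. Only the constant term of \<open>Q\<close> survives.
\<close>

lemma elim_poly_mpoly_eval:
  assumes Q: "Q \<in> carrier (mpoly_ring R {1..r})" and \<iota>: "chart s n \<iota>"
  shows "elim_poly s n d \<iota> (mpoly_eval mconst (\<lambda>i. dehom \<iota> (gen_poly s n d i)) Q) =
    elim_coeff s n d \<iota> (Poly_Mapping.lookup Q 0)"
proof -
  let ?E = "elim_poly s n d \<iota>"
  have "?E (mpoly_eval mconst g Q) = mpoly_eval (elim_coeff s n d \<iota>) (\<lambda>i. ?E (g i)) Q" for g
    by (simp add: mpoly_eval_def unital_hom.hom_sum[OF elim_poly_hom] unital_hom.mult[OF elim_poly_hom]
        unital_hom.hom_prod[OF elim_poly_hom] unital_hom.power[OF elim_poly_hom] elim_poly_mconst)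
  then show ?thesis
    using mpoly_eval_vanishing[OF elim_coeff_hom Q] by (simp add: elim_poly_dehom elim_poly_gen_poly[OF \<iota>])
qed

theorem mainTheorem5:
  fixes s r :: nat and n :: "nat \<Rightarrow> nat" and d :: "nat \<Rightarrow> nat \<Rightarrow> nat"
    and a :: "'k::idom apoly"
  assumes "1 \<le> s"
    and "1 \<le> n 1"
    and "mono_on {1..s} n"
    and "\<And>i j. i \<in> {1..r} \<Longrightarrow> j \<in> {1..s} \<Longrightarrow> 1 \<le> d i j"
    and "a \<in> carrier (ring_A s n r d)"
  shows "a \<in> resultant_ideal s n r d \<longleftrightarrow>
    (\<exists>Q \<in> carrier (mpoly_ring (carrier (ring_A s n r d)) {1..r}).
       Poly_Mapping.lookup Q 0 = 0 \<and>
       mconst a = mpoly_eval mconst (dehom_poly s n d) Q)"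
proof -
  let ?\<kappa> = "\<lambda>j. n j + 1"
  let ?AT = "carrier (mpoly_ring (carrier (ring_A s n r d)) {1..r})"
  have \<kappa>: "chart s n ?\<kappa>" by (simp add: chart_def)
  have dehom_poly: "dehom_poly s n d = (\<lambda>i. dehom ?\<kappa> (gen_poly s n d i))"
    by (simp add: fun_eq_iff dehom_poly_def dehom_def dehom_var_def)
  note AT = unital_subringD[OF unital_subring_mpoly_ring[OF unital_subring_ring_A]]
  note E = mpoly_eval_hom[OF mconst_hom]
  have "elim_coeff s n d ?\<kappa> a = 0 \<longleftrightarrow>
    (\<exists>Q\<in>?AT. Poly_Mapping.lookup Q 0 = 0 \<and> mconst a = mpoly_eval mconst (dehom_poly s n d) Q)"
  proof
    assume zero: "elim_coeff s n d ?\<kappa> a = 0"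
    let ?Q = "mconst a - shift_coeff s d ?\<kappa> mvar a"
    have "?Q \<in> ?AT"
      using assms(5) by (intro AT(3) mconst_in_mpoly_ring shift_coeff_in_mpoly_ring)
    moreover have "Poly_Mapping.lookup ?Q 0 = 0"
      by (simp add: lookup_minus lookup_shift_coeff_0 mconst_def)
    moreover have "mpoly_eval mconst (dehom_poly s n d) (shift_coeff s d ?\<kappa> mvar a) =
        elim_coeff s n d ?\<kappa> a"
      unfolding elim_coeff_def dehom_poly mpoly_eval_shift_coeff[OF mconst_hom]
      unfolding shift_coeff_def by (rule refl)
    then have "mpoly_eval mconst (dehom_poly s n d) ?Q = mconst a"
      unfolding unital_hom.diff[OF E] mpoly_eval_mconst[OF mconst_hom] zero by simp
    ultimately show "\<exists>Q\<in>?AT. Poly_Mapping.lookup Q 0 = 0 \<and> mconst a = mpoly_eval mconst (dehom_poly s n d) Q"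
      by metis
  next
    assume "\<exists>Q\<in>?AT. Poly_Mapping.lookup Q 0 = 0 \<and> mconst a = mpoly_eval mconst (dehom_poly s n d) Q"
    then obtain Q where Q: "Q \<in> ?AT" "Poly_Mapping.lookup Q 0 = 0"
      "mconst a = mpoly_eval mconst (dehom_poly s n d) Q" by blast
    have "elim_coeff s n d ?\<kappa> a = elim_poly s n d ?\<kappa> (mconst a)" by (simp add: elim_poly_mconst)
    also have "\<dots> = elim_coeff s n d ?\<kappa> 0"
      using elim_poly_mpoly_eval[OF Q(1) \<kappa>] by (simp add: Q dehom_poly)
    also have "\<dots> = 0" by (rule unital_hom.zero[OF elim_coeff_hom])
    finally show "elim_coeff s n d ?\<kappa> a = 0" .
  qed
  then show ?thesis by (simp add: resultant_ideal_iff[OF assms(5) \<kappa>])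
qed

end
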